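(* Let $H_1$ and $H_2$ be maximal sectorial relations in a Hilbert space $\mathfrak{H}$, with $A_j^{1/2}$, $A_{js}^{1/2}$, $B_j$ ($j=1,2$), $B_\oplus=B_1\oplus B_2$ and the relation $K$ from $\mathfrak{H}\times\mathfrak{H}$ to $\mathfrak{H}$ as in the context. Assume that the closures $\mathfrak{E}$ and $\mathfrak{D}$ in $\mathfrak{H}\times\mathfrak{H}$ of $$\mathfrak{E}_0=\{\{A_{1s}^{1/2}f,A_{2s}^{1/2}f\}:f\in\operatorname{dom}H_1\cap\operatorname{dom}H_2\},$$ $$\mathfrak{D}_0=\{\{(I+iB_1)A_{1s}^{1/2}f,(I+iB_2)A_{2s}^{1/2}f\}:f\in\operatorname{dom}H_1\cap\operatorname{dom}H_2\}$$ satisfy $\mathfrak{E}=\mathfrak{D}$. Then the following statements are equivalent for a relation $\widetilde{H}$ in $\mathfrak{H}$: (i) $\widetilde{H}$ is an extremal maximal sectorial extension of $H_1+H_2$; (ii) $\widetilde{H}=T_{\mathfrak{L}}^{*}(I+iB_\oplus)T_{\mathfrak{L}}^{**}$, where $T_{\mathfrak{L}}$ is the restriction of the operator part $(K^* )_s$ to a linear subspace $\mathfrak{L}$ satisfying $$\operatorname{dom}(H_1+H_2)\subset\mathfrak{L}\subset\operatorname{dom}K^*.$$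
   Context: Hilbert spaces are complex with inner product linear in the first entry; $\mathbf{B}(\mathfrak{H})$ is the set of bounded everywhere defined operators on $\mathfrak{H}$. A linear relation $T$ from $\mathfrak{H}$ to $\mathfrak{K}$ is a linear subspace of $\mathfrak{H}\times\mathfrak{K}$; operators are identified with their graphs. $\operatorname{dom}T$ is the set of first entries, $\ker T=\{f:\{f,0\}\in T\}$, $\operatorname{mul}T=\{k:\{0,k\}\in T\}$, $T^{-1}=\{\{g,f\}:\{f,g\}\in T\}$. The adjoint is $T^*=\{\{k,h\}\in\mathfrak{K}\times\mathfrak{H}:(k,f')=(h,f)\ \forall\{f,f'\}\in T\}$; $T^{**}$ is the closure of $T$. Products: $AB=\{\{f,h\}:\{f,g\}\in B,\ \{g,h\}\in A\text{ for some }g\}$; sums: $A+B=\{\{f,g+h\}:\{f,g\}\in A,\ \{f,h\}\in B\}$. The (orthogonal) operator part of a closed relation $R$ is the operator $R_s=\{\{f,g\}\in R:g\perp\operatorname{mul}R\}$, with $\operatorname{dom}R_s=\operatorname{dom}R$. A relation $S$ in $\mathfrak{H}$ is sectorial (vertex at the origin, semi-angle $\alpha\in[0,\pi/2)$) if $|\operatorname{Im}(h',h)|\le(\tan\alpha)\operatorname{Re}(h',h)$ for all $\{h,h'\}\in S$; it is maximal sectorial if it has no proper sectorial extension in $\mathfrak{H}$. If $S$ is sectorial, so is $S^{-1}$. For sectorial $S$ the form $\mathfrak{t}_S[\varphi,\psi]=(\varphi',\psi)$, $\{\varphi,\varphi'\},\{\psi,\psi'\}\in S$, $\operatorname{dom}\mathfrak{t}_S=\operatorname{dom}S$,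 is well defined, sectorial and closable. Closed (not necessarily densely defined) sectorial forms $\mathfrak{t}$ and maximal sectorial relations $H$ are in one-to-one correspondence, $\mathfrak{t}=\mathfrak{t}_H$ closed, via $H=\{\{\varphi,\varphi'\}:\varphi\in\operatorname{dom}\mathfrak{t},\ \mathfrak{t}[\varphi,\psi]=(\varphi',\psi)\ \forall\psi\in\operatorname{dom}\mathfrak{t}\}$. The Friedrichs extension $S_F$ is the maximal sectorial relation corresponding to the closure of $\mathfrak{t}_S$; the Krein extension is $S_K=((S^{-1})_F)^{-1}$. A maximal sectorial extension $H$ of a sectorial relation $S$ is extremal precisely when the closed sectorial form corresponding to $H$ is a restriction of the closed sectorial form corresponding to $S_K$. Pair data. For $j=1,2$ let $\mathfrak{t}_{H_j}$ be the closed sectorial form corresponding to $H_j$, and let $A_j$ be the nonnegative selfadjoint relation corresponding to the closed nonnegative form $\operatorname{Re}\mathfrak{t}_{H_j}$, where $(\operatorname{Re}\mathfrak{t})[h,k]=\tfrac12(\mathfrak{t}[h,k]+\overline{\mathfrak{t}[k,h]})$. Write $A_j=A_{js}\oplus(\{0\}\times\operatorname{mul}A_j)$, where $A_{js}$ is the operator part of $A_j$, a nonnegative selfadjoint operator in $\mathfrak{H}\ominus\operatorname{mul}A_j$; $A_{js}^{1/2}$ is its nonnegative square root and $A_j^{1/2}=A_{js}^{1/2}\oplus(\{0\}\times\operatorname{mul}A_j)$. $B_j\in\mathbf{B}(\mathfrak{H})$ is the unique selfadjoint operator, zero on $\ker A_j\oplus\operatorname{mul}A_j$, such that $\mathfrak{t}_{H_j}[h,k]=((I+iB_j)A_{js}^{1/2}h,A_{js}^{1/2}k)$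 for $h,k\in\operatorname{dom}\mathfrak{t}_{H_j}=\operatorname{dom}A_j^{1/2}$; then $H_j=A_j^{1/2}(I+iB_j)A_j^{1/2}$. $B_\oplus=B_1\oplus B_2$ is the orthogonal sum acting in $\mathfrak{H}\times\mathfrak{H}$. The sum $H_1+H_2$ is a sectorial relation with domain $\operatorname{dom}H_1\cap\operatorname{dom}H_2$. The linear relation $K$ from $\mathfrak{H}\times\mathfrak{H}$ to $\mathfrak{H}$ is $$K=\Big\{\big\{\{(I+iB_1)A_{1s}^{1/2}f,(I+iB_2)A_{2s}^{1/2}f\},f_1'+f_2'\big\}:\ \{(I+iB_j)A_{js}^{1/2}f,f_j'\}\in A_j^{1/2},\ j=1,2\Big\},$$ with $\operatorname{dom}K=\mathfrak{D}_0$. *)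

theory Defs
  imports "HOL-Analysis.Analysis"
begin

section \<open>Complex Hilbert spaces\<close>

text \<open>The inner product is linear in the first entry. Completeness and the norm topology come from
  the library class \<^class>\<open>banach\<close>.\<close>

class complex_hilbert = banach +
  fixes scaleC :: "complex \<Rightarrow> 'a \<Rightarrow> 'a" (infixr "*\<^sub>C" 75)
    and cinner :: "'a \<Rightarrow> 'a \<Rightarrow> complex"
  assumes scaleR_scaleC: "r *\<^sub>R x = complex_of_real r *\<^sub>C x"
    and scaleC_add_right: "a *\<^sub>C (x + y) = a *\<^sub>C x + a *\<^sub>C y"
    and scaleC_add_left: "(a + b) *\<^sub>C x = a *\<^sub>C x + b *\<^sub>C x"
    and scaleC_scaleC: "a *\<^sub>C (b *\<^sub>C x) = (a * b) *\<^sub>C x"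
    and cinner_commute: "cinner x y = cnj (cinner y x)"
    and cinner_add_left: "cinner (x + y) z = cinner x z + cinner y z"
    and cinner_scaleC_left: "cinner (a *\<^sub>C x) y = a * cinner x y"
    and cinner_self: "cinner x x = complex_of_real ((norm x)\<^sup>2)"

global_interpretation complex_vector:
    vector_space "scaleC :: complex \<Rightarrow> 'a \<Rightarrow> 'a :: complex_hilbert"
  defines csubspace = complex_vector.subspace
proof unfold_locales
  fix x :: 'a
  show "1 *\<^sub>C x = x"
    using scaleR_scaleC[of 1 x] by simp
qed (simp_all add: scaleC_add_right scaleC_add_left scaleC_scaleC)

instantiation complex :: complex_hilbert
begin

definition scaleC_complex :: "complex \<Rightarrow> complex \<Rightarrow> complex"
  where "scaleC_complex a x = a * x"

definition cinner_complex :: "complex \<Rightarrow> complex \<Rightarrow> complex"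
  where "cinner_complex x y = x * cnj y"

instance
  by standard (auto simp: scaleC_complex_def cinner_complex_def scaleR_conv_of_real
      algebra_simps complex_norm_square simp flip: of_real_power)

end

instantiation prod :: (complex_hilbert, complex_hilbert) complex_hilbert
begin

definition scaleC_prod :: "complex \<Rightarrow> 'a \<times> 'b \<Rightarrow> 'a \<times> 'b"
  where "scaleC_prod a x = (a *\<^sub>C fst x, a *\<^sub>C snd x)"

definition cinner_prod :: "'a \<times> 'b \<Rightarrow> 'a \<times> 'b \<Rightarrow> complex"
  where "cinner_prod x y = cinner (fst x) (fst y) + cinner (snd x) (snd y)"

instance
proof
  fix x y z :: "'a \<times> 'b" and a b :: complex and r :: real
  show "r *\<^sub>R x = complex_of_real r *\<^sub>C x"
    by (simp add: scaleC_prod_def scaleR_prod_def scaleR_scaleC)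
  show "a *\<^sub>C (x + y) = a *\<^sub>C x + a *\<^sub>C y"
    by (simp add: scaleC_prod_def scaleC_add_right)
  show "(a + b) *\<^sub>C x = a *\<^sub>C x + b *\<^sub>C x"
    by (simp add: scaleC_prod_def scaleC_add_left)
  show "a *\<^sub>C (b *\<^sub>C x) = (a * b) *\<^sub>C x"
    by (simp add: scaleC_prod_def scaleC_scaleC)
  show "cinner x y = cnj (cinner y x)"
    unfolding cinner_prod_def complex_cnj_add
    by (metis cinner_commute)
  show "cinner (x + y) z = cinner x z + cinner y z"
    by (simp add: cinner_prod_def cinner_add_left)
  show "cinner (a *\<^sub>C x) y = a * cinner x y"
    by (simp add: cinner_prod_def scaleC_prod_def cinner_scaleC_left distrib_left)
  show "cinner x x = complex_of_real ((norm x)\<^sup>2)"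
    by (simp add: cinner_prod_def cinner_self norm_prod_def)
qed

end

definition ortho_compl :: "'a::complex_hilbert set \<Rightarrow> 'a set"
  where "ortho_compl M = {x. \<forall>m\<in>M. cinner x m = 0}"


section \<open>Linear relations\<close>

text \<open>The domain and the inverse of a relation are the library's \<^const>\<open>Domain\<close> and
  \<^const>\<open>converse\<close>.\<close>

definition linear_relation :: "('a::complex_hilbert \<times> 'b::complex_hilbert) set \<Rightarrow> bool"
  where "linear_relation T \<longleftrightarrow> csubspace T"

definition rel_ker :: "('a::complex_hilbert \<times> 'b::complex_hilbert) set \<Rightarrow> 'a set"
  where "rel_ker T = {f. (f, 0) \<in> T}"

definition rel_mul :: "('a::complex_hilbert \<times> 'b::complex_hilbert) set \<Rightarrow> 'b set"
  where "rel_mul T = {k. (0, k) \<in> T}"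

definition adjoint_rel ::
    "('a::complex_hilbert \<times> 'b::complex_hilbert) set \<Rightarrow> ('b \<times> 'a) set"
  where "adjoint_rel T = {(k, h). \<forall>(f, f') \<in> T. cinner k f' = cinner h f}"

text \<open>The product \<open>A B\<close> applies \<open>B\<close> first, whereas the library's \<open>O\<close> applies its left argument
  first.\<close>

abbreviation rel_prod :: "('b \<times> 'c) set \<Rightarrow> ('a \<times> 'b) set \<Rightarrow> ('a \<times> 'c) set"
    (infixl "\<odot>" 75)
  where "A \<odot> B \<equiv> B O A"

definition rel_sum ::
    "('a \<times> 'b::plus) set \<Rightarrow> ('a \<times> 'b) set \<Rightarrow> ('a \<times> 'b) set" (infixl "\<boxplus>" 65)
  where "A \<boxplus> B = {(f, g + h) |f g h. (f, g) \<in> A \<and> (f, h) \<in> B}"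

definition graph_of :: "('a \<Rightarrow> 'b) \<Rightarrow> ('a \<times> 'b) set"
  where "graph_of F = {(x, F x) |x. True}"

definition rel_restrict :: "('a \<times> 'b) set \<Rightarrow> 'a set \<Rightarrow> ('a \<times> 'b) set"
  where "rel_restrict T L = {(f, g) \<in> T. f \<in> L}"

definition operator_part ::
    "('a::complex_hilbert \<times> 'b::complex_hilbert) set \<Rightarrow> ('a \<times> 'b) set"
  where "operator_part R = {(f, g) \<in> R. g \<in> ortho_compl (rel_mul R)}"

definition nonneg_relation :: "('a::complex_hilbert \<times> 'a) set \<Rightarrow> bool"
  where "nonneg_relation R \<longleftrightarrow>
    (\<forall>(f, g) \<in> R. Im (cinner g f) = 0 \<and> 0 \<le> Re (cinner g f))"

text \<open>\<open>R\<close> is a nonnegative selfadjoint operator in the Hilbert space \<open>M\<close>, a closed subspace of the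
  ambient space; the adjoint of \<open>R\<close> in \<open>M\<close> is the part of \<^term>\<open>adjoint_rel R\<close> inside \<open>M \<times> M\<close>.\<close>

definition nonneg_selfadjoint_operator_in ::
    "'a::complex_hilbert set \<Rightarrow> ('a \<times> 'a) set \<Rightarrow> bool"
  where "nonneg_selfadjoint_operator_in M R \<longleftrightarrow>
    R \<subseteq> M \<times> M \<and> linear_relation R \<and> single_valued R \<and>
    adjoint_rel R \<inter> (M \<times> M) = R \<and> nonneg_relation R"

definition nonneg_sqrt_in ::
    "'a::complex_hilbert set \<Rightarrow> ('a \<times> 'a) set \<Rightarrow> ('a \<times> 'a) set \<Rightarrow> bool"
  where "nonneg_sqrt_in M R Q \<longleftrightarrow> nonneg_selfadjoint_operator_in M R \<and> R \<odot> R = Q"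

definition bounded_selfadjoint :: "('a::complex_hilbert \<Rightarrow> 'a) \<Rightarrow> bool"
  where "bounded_selfadjoint B \<longleftrightarrow>
    bounded_linear B \<and> Vector_Spaces.linear scaleC scaleC B \<and>
    adjoint_rel (graph_of B) = graph_of B"

text \<open>The operator \<open>I + iB\<close>.\<close>

definition one_plus_i :: "('a::complex_hilbert \<Rightarrow> 'a) \<Rightarrow> 'a \<Rightarrow> 'a"
  where "one_plus_i B x = x + \<i> *\<^sub>C B x"


section \<open>Sectorial relations\<close>

text \<open>The condition \<open>0 \<le> Re z\<close> says that \<open>z\<close> lies in the closed right half-plane. It follows from
  the inequality when \<open>\<alpha> > 0\<close>, but has to be stated for \<open>\<alpha> = 0\<close>.\<close>

definition in_sector :: "real \<Rightarrow> complex \<Rightarrow> bool"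
  where "in_sector \<alpha> z \<longleftrightarrow> 0 \<le> Re z \<and> \<bar>Im z\<bar> \<le> tan \<alpha> * Re z"

definition sectorial :: "('a::complex_hilbert \<times> 'a) set \<Rightarrow> bool"
  where "sectorial S \<longleftrightarrow> linear_relation S \<and>
    (\<exists>\<alpha>. 0 \<le> \<alpha> \<and> \<alpha> < pi / 2 \<and> (\<forall>(h, h') \<in> S. in_sector \<alpha> (cinner h' h)))"

definition maximal_sectorial :: "('a::complex_hilbert \<times> 'a) set \<Rightarrow> bool"
  where "maximal_sectorial H \<longleftrightarrow> sectorial H \<and> (\<forall>T. sectorial T \<and> H \<subseteq> T \<longrightarrow> T = H)"


section \<open>Forms\<close>

text \<open>A form is a domain together with a value function, whose values outside the domain are
  meaningless and never used.\<close>

datatype 'a form = Form (fdom: "'a set") (fval: "'a \<Rightarrow> 'a \<Rightarrow> complex")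

definition form_restriction :: "'a form \<Rightarrow> 'a form \<Rightarrow> bool"
  where "form_restriction s t \<longleftrightarrow> fdom s \<subseteq> fdom t \<and>
    (\<forall>\<phi>\<in>fdom s. \<forall>\<psi>\<in>fdom s. fval s \<phi> \<psi> = fval t \<phi> \<psi>)"

definition sesquilinear_form :: "'a::complex_hilbert form \<Rightarrow> bool"
  where "sesquilinear_form t \<longleftrightarrow> csubspace (fdom t) \<and>
    (\<forall>\<phi>\<in>fdom t. \<forall>\<psi>\<in>fdom t. \<forall>\<omega>\<in>fdom t. \<forall>a.
      fval t (\<phi> + \<psi>) \<omega> = fval t \<phi> \<omega> + fval t \<psi> \<omega> \<and>
      fval t \<omega> (\<phi> + \<psi>) = fval t \<omega> \<phi> + fval t \<omega> \<psi> \<and>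
      fval t (a *\<^sub>C \<phi>) \<omega> = a * fval t \<phi> \<omega> \<and>
      fval t \<omega> (a *\<^sub>C \<phi>) = cnj a * fval t \<omega> \<phi>)"

definition sectorial_form :: "'a::complex_hilbert form \<Rightarrow> bool"
  where "sectorial_form t \<longleftrightarrow> sesquilinear_form t \<and>
    (\<exists>\<alpha>. 0 \<le> \<alpha> \<and> \<alpha> < pi / 2 \<and> (\<forall>\<phi>\<in>fdom t. in_sector \<alpha> (fval t \<phi> \<phi>)))"

text \<open>Kato's \<open>t\<close>-convergence of a sequence in the domain of \<open>t\<close>.\<close>

definition form_conv :: "'a::complex_hilbert form \<Rightarrow> (nat \<Rightarrow> 'a) \<Rightarrow> 'a \<Rightarrow> bool"
  where "form_conv t u \<phi> \<longleftrightarrow> (\<forall>n. u n \<in> fdom t) \<and> u \<longlonglongrightarrow> \<phi> \<and>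
    (\<forall>e>0. \<exists>N. \<forall>m\<ge>N. \<forall>n\<ge>N. cmod (fval t (u n - u m) (u n - u m)) < e)"

definition closed_form :: "'a::complex_hilbert form \<Rightarrow> bool"
  where "closed_form t \<longleftrightarrow> (\<forall>u \<phi>. form_conv t u \<phi> \<longrightarrow>
    \<phi> \<in> fdom t \<and> (\<lambda>n. fval t (u n - \<phi>) (u n - \<phi>)) \<longlonglongrightarrow> 0)"

text \<open>The closure of a closable sectorial form; its values are well defined in that case.\<close>

definition form_closure :: "'a::complex_hilbert form \<Rightarrow> 'a form"
  where "form_closure t = Form {\<phi>. \<exists>u. form_conv t u \<phi>}
    (\<lambda>\<phi> \<psi>. THE c. \<forall>u v. form_conv t u \<phi> \<and> form_conv t v \<psi> \<longrightarrow>
      (\<lambda>n. fval t (u n) (v n)) \<longlonglongrightarrow> c)"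

definition form_Re :: "'a form \<Rightarrow> 'a form"
  where "form_Re t = Form (fdom t) (\<lambda>h k. (fval t h k + cnj (fval t k h)) / 2)"

text \<open>The form \<open>t\<^sub>S\<close> of a sectorial relation \<open>S\<close>; since \<open>mul S\<close> is orthogonal to \<open>dom S\<close>, its values
  do not depend on the choice of \<open>\<phi>'\<close>.\<close>

definition form_of_rel :: "('a::complex_hilbert \<times> 'a) set \<Rightarrow> 'a form"
  where "form_of_rel S = Form (Domain S)
    (\<lambda>\<phi> \<psi>. THE c. \<exists>\<phi>'. (\<phi>, \<phi>') \<in> S \<and> c = cinner \<phi>' \<psi>)"

definition rel_of_form :: "'a::complex_hilbert form \<Rightarrow> ('a \<times> 'a) set"
  where "rel_of_form t =
    {(\<phi>, \<phi>'). \<phi> \<in> fdom t \<and> (\<forall>\<psi>\<in>fdom t. fval t \<phi> \<psi> = cinner \<phi>' \<psi>)}"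

text \<open>\<open>t\<close> is the closed sectorial form corresponding to \<open>H\<close>.\<close>

definition corresponding_form :: "('a::complex_hilbert \<times> 'a) set \<Rightarrow> 'a form \<Rightarrow> bool"
  where "corresponding_form H t \<longleftrightarrow> sectorial_form t \<and> closed_form t \<and> H = rel_of_form t"


section \<open>Friedrichs, Krein and extremal extensions\<close>

definition friedrichs_ext :: "('a::complex_hilbert \<times> 'a) set \<Rightarrow> ('a \<times> 'a) set"
  where "friedrichs_ext S = rel_of_form (form_closure (form_of_rel S))"

definition krein_ext :: "('a::complex_hilbert \<times> 'a) set \<Rightarrow> ('a \<times> 'a) set"
  where "krein_ext S = converse (friedrichs_ext (converse S))"

text \<open>Extremality: the form of \<open>H\<close> is a restriction of the form of the Krein extension of \<open>S\<close>.\<close>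

definition extremal_maximal_sectorial_ext ::
    "('a::complex_hilbert \<times> 'a) set \<Rightarrow> ('a \<times> 'a) set \<Rightarrow> bool"
  where "extremal_maximal_sectorial_ext S H \<longleftrightarrow> maximal_sectorial H \<and> S \<subseteq> H \<and>
    (\<exists>tH tK. corresponding_form H tH \<and> corresponding_form (krein_ext S) tK \<and>
      form_restriction tH tK)"


section \<open>Data attached to a pair of maximal sectorial relations\<close>

text \<open>In what follows \<open>R\<close> is the (graph of the) operator \<open>A\<^sub>s\<^sup>1\<^sup>/\<^sup>2\<close>. The next definition adds the
  multivalued part \<open>{0} \<times> mul A\<close>, giving the relation \<open>A\<^sup>1\<^sup>/\<^sup>2\<close>.\<close>

definition add_mul ::
    "('a::complex_hilbert \<times> 'a) set \<Rightarrow> 'a set \<Rightarrow> ('a \<times> 'a) set"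
  where "add_mul R M = {(f, g + m) |f g m. (f, g) \<in> R \<and> m \<in> M}"

text \<open>For the closed sectorial form \<open>t\<close>: \<open>A\<close> corresponds to \<open>Re t\<close>, \<open>R\<close> is the square root of
  \<open>A\<^sub>s\<close> in the orthogonal complement of \<open>mul A\<close>, and \<open>B\<close> vanishes on \<open>ker A \<oplus> mul A\<close> and satisfies
  \<open>t[h, k] = ((I + iB) R h, R k)\<close> on \<open>dom t = dom R\<close>. These conditions determine \<open>A\<close>, \<open>R\<close> and
  \<open>B\<close>.\<close>

definition half_power_data ::
    "('a::complex_hilbert) form \<Rightarrow> ('a \<times> 'a) set \<Rightarrow> ('a \<times> 'a) set \<Rightarrow> ('a \<Rightarrow> 'a) \<Rightarrow> bool"
  where "half_power_data t A R B \<longleftrightarrow>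
    A = rel_of_form (form_Re t) \<and>
    nonneg_sqrt_in (ortho_compl (rel_mul A)) R (operator_part A) \<and>
    bounded_selfadjoint B \<and>
    (\<forall>x\<in>rel_ker A. \<forall>y\<in>rel_mul A. B (x + y) = 0) \<and>
    fdom t = Domain R \<and>
    (\<forall>(h, h') \<in> R. \<forall>(k, k') \<in> R. fval t h k = cinner (one_plus_i B h') k')"

text \<open>With \<open>D = dom H\<^sub>1 \<inter> dom H\<^sub>2\<close>, the following are the spaces \<open>\<EE>\<^sub>0\<close> and \<open>\<DD>\<^sub>0\<close> and the relation
  \<open>K\<close>, whose arguments \<open>Q1, Q2\<close> are the relations \<open>A\<^sub>1\<^sup>1\<^sup>/\<^sup>2, A\<^sub>2\<^sup>1\<^sup>/\<^sup>2\<close>.\<close>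

definition space_E0 ::
    "'a set \<Rightarrow> ('a::complex_hilbert \<times> 'a) set \<Rightarrow> ('a \<times> 'a) set \<Rightarrow> ('a \<times> 'a) set"
  where "space_E0 D R1 R2 =
    {(g1, g2) |f g1 g2. f \<in> D \<and> (f, g1) \<in> R1 \<and> (f, g2) \<in> R2}"

definition space_D0 ::
    "'a set \<Rightarrow> ('a::complex_hilbert \<times> 'a) set \<Rightarrow> ('a \<times> 'a) set \<Rightarrow>
      ('a \<Rightarrow> 'a) \<Rightarrow> ('a \<Rightarrow> 'a) \<Rightarrow> ('a \<times> 'a) set"
  where "space_D0 D R1 R2 B1 B2 =
    {(one_plus_i B1 g1, one_plus_i B2 g2) |f g1 g2. f \<in> D \<and> (f, g1) \<in> R1 \<and> (f, g2) \<in> R2}"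

definition rel_K ::
    "('a::complex_hilbert \<times> 'a) set \<Rightarrow> ('a \<times> 'a) set \<Rightarrow> ('a \<Rightarrow> 'a) \<Rightarrow> ('a \<Rightarrow> 'a) \<Rightarrow>
      ('a \<times> 'a) set \<Rightarrow> ('a \<times> 'a) set \<Rightarrow> (('a \<times> 'a) \<times> 'a) set"
  where "rel_K R1 R2 B1 B2 Q1 Q2 =
    {((one_plus_i B1 g1, one_plus_i B2 g2), f1' + f2') |f g1 g2 f1' f2'.
      (f, g1) \<in> R1 \<and> (f, g2) \<in> R2 \<and>
      (one_plus_i B1 g1, f1') \<in> Q1 \<and> (one_plus_i B2 g2, f2') \<in> Q2}"

end

theory Submission
  imports Defs
begin

text \<open>Put \<open>S = H\<^sub>1 + H\<^sub>2\<close>, \<open>C = I + iB\<^sub>\<oplus>\<close> and \<open>J f = {A\<^sub>1\<^sub>s\<^sup>1\<^sup>/\<^sup>2 f, A\<^sub>2\<^sub>s\<^sup>1\<^sup>/\<^sup>2 f}\<close>. Then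
  \<open>(f', g) = (C J f, J g)\<close> for \<open>{f, f'} \<in> S\<close> and \<open>g \<in> dom S\<close>, and \<open>K\<close> consists of the pairs \<open>{C J f, f'}\<close>.
  The form of \<open>S\<^sup>-\<^sup>1\<close> is \<open>(J f, C J g)\<close>, which gives \<open>S\<^sub>K\<close> as the set of \<open>{\<omega>, \<phi>}\<close> such that
  \<open>{\<omega>, g} \<in> K\<^sup>*\<close> and \<open>{C g, \<phi>} \<in> K\<^sup>*\<^sup>*\<close> for some \<open>g\<close>. Since \<open>\<EE> = \<DD>\<close>, here \<open>g\<close> lies in \<open>\<DD>\<close>, so that
  \<open>{\<omega>, g} \<in> (K\<^sup>*)\<^sub>s\<close>: the closed form of \<open>S\<^sub>K\<close> is \<open>(C (K\<^sup>*)\<^sub>s \<phi>, (K\<^sup>*)\<^sub>s \<psi>)\<close>. Its closed restrictions are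
  exactly the forms \<open>(C T\<^sup>*\<^sup>* \<phi>, T\<^sup>*\<^sup>* \<psi>)\<close> with \<open>T\<close> a restriction of \<open>(K\<^sup>*)\<^sub>s\<close>, and such a form has the
  relation \<open>T\<^sup>* C T\<^sup>*\<^sup>*\<close>.\<close>

section \<open>Geometry of complex Hilbert spaces\<close>

text \<open>The hypothesis \<EE> = \<DD> does two things: it identifies \<DD> with the closure of
  dom K, and it makes \<DD> invariant under C. Components orthogonal to \<DD> are then invisible to
  every vector C J f and C g with g in \<DD>, which is why K^* can be traded for its operator part.
  The pairs {J f, f'}, that is K with C removed, carry the form of the inverse of S; since |C x|
  \<ge> |x|, their closure can be compared with the closure of K. Extremality only provides some
  closed form whose relation is S_K. Exhibiting one such form is therefore not enough, and a closed
  sectorial form has to be shown to be determined by its relation. This and the maximality of T^* C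
  T^** both rest on Lax-Milgram for I \<oplus> C on the graph of T, a closed subspace of a product
  space: it makes the range of T^* C T^** + I the whole space.\<close>

lemma cinner_add_right: "cinner x (y + z) = cinner x y + cinner x z"
  by (metis cinner_add_left cinner_commute complex_cnj_add)

lemma cinner_scaleC_right: "cinner x (a *\<^sub>C y) = cnj a * cinner x y"
  by (metis cinner_scaleC_left cinner_commute complex_cnj_mult)

lemma cinner_zero_left [simp]: "cinner 0 x = 0"
  using cinner_add_left[of 0 0 x] by simp

lemma cinner_zero_right [simp]: "cinner x 0 = 0"
  using cinner_add_right[of x 0 0] by simp

lemma cinner_minus_left [simp]: "cinner (- x) y = - cinner x y"
  using cinner_add_left[of x "- x" y] by (simp add: add_eq_0_iff2)

lemma cinner_minus_right [simp]: "cinner x (- y) = - cinner x y"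
  using cinner_add_right[of x y "- y"] by (simp add: add_eq_0_iff2)

lemma cinner_diff_left: "cinner (x - y) z = cinner x z - cinner y z"
  using cinner_add_left[of x "- y" z] by simp

lemma cinner_diff_right: "cinner x (y - z) = cinner x y - cinner x z"
  using cinner_add_right[of x y "- z"] by simp

lemmas cinner_linear = cinner_add_left cinner_add_right cinner_diff_left cinner_diff_right
  cinner_scaleC_left cinner_scaleC_right

lemma cinner_self_eq_0 [simp]: "cinner x x = 0 \<longleftrightarrow> x = 0"
  by (simp add: cinner_self)

lemma Re_cinner_commute: "Re (cinner x y) = Re (cinner y x)"
  by (metis cinner_commute cnj.sel(1))

lemma power2_norm_eq_cinner: "(norm x)\<^sup>2 = Re (cinner x x)"
  by (simp add: cinner_self)

lemma norm_diff_sq: "(norm (x - y))\<^sup>2 = (norm x)\<^sup>2 - 2 * Re (cinner x y) + (norm y)\<^sup>2"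
  using Re_cinner_commute[of x y] by (simp add: power2_norm_eq_cinner cinner_linear)

lemma norm_add_sq: "(norm (x + y))\<^sup>2 = (norm x)\<^sup>2 + 2 * Re (cinner x y) + (norm y)\<^sup>2"
  using Re_cinner_commute[of x y] by (simp add: power2_norm_eq_cinner cinner_linear)

lemma cmod_mult_self: "cmod z * cmod z = Re z * Re z + Im z * Im z"
  using cmod_power2[of z] by (simp add: power2_eq_square)

lemma norm_scaleC: "norm (a *\<^sub>C x) = cmod a * norm x"
proof -
  have "complex_of_real ((norm (a *\<^sub>C x))\<^sup>2) = (a * cnj a) * cinner x x"
    by (simp only: cinner_self[symmetric] cinner_linear mult.assoc mult.left_commute)
  also have "\<dots> = complex_of_real ((cmod a * norm x)\<^sup>2)"
    by (simp add: cinner_self power_mult_distrib flip: complex_norm_square)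
  finally have "(norm (a *\<^sub>C x))\<^sup>2 = (cmod a * norm x)\<^sup>2"
    by (simp only: of_real_eq_iff)
  then show ?thesis by simp
qed

text \<open>The variational test for orthogonality. Subtracting the multiple of y changes the
  squared norm by s |(x,y)|^2 (s |y|^2 - 2), which is negative unless (x,y) = 0. The summand 1 in s
  gives s |y|^2 < 1 and covers y = 0.\<close>

lemma norm_sub_proj_sq:
  assumes s_def: "s = 1 / ((norm y)\<^sup>2 + 1)"
    and le: "(norm x)\<^sup>2 \<le> (norm (x - (of_real s * cinner x y) *\<^sub>C y))\<^sup>2"
  shows "cinner x y = 0"
proof (rule ccontr)
  let ?c = "cinner x y"
  assume "?c \<noteq> 0"
  then have c: "(cmod ?c)\<^sup>2 > 0" by simp
  have s: "s > 0" "s * (norm y)\<^sup>2 < 1"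
    by (simp_all add: s_def add_nonneg_pos divide_simps)
  have "Re (cinner x ((of_real s * ?c) *\<^sub>C y)) = s * (cmod ?c)\<^sup>2"
    by (simp add: cinner_linear cmod_mult_self power2_eq_square algebra_simps)
  moreover have "(norm ((of_real s * ?c) *\<^sub>C y))\<^sup>2 = s * (cmod ?c)\<^sup>2 * (s * (norm y)\<^sup>2)"
    by (simp add: norm_scaleC norm_mult power_mult_distrib power2_eq_square)
  ultimately have "0 \<le> s * (cmod ?c)\<^sup>2 * (s * (norm y)\<^sup>2 - 2)"
    using le by (simp add: norm_diff_sq algebra_simps)
  moreover have "s * (cmod ?c)\<^sup>2 * (s * (norm y)\<^sup>2 - 2) < 0"
    using s c by (intro mult_pos_neg mult_pos_pos) auto
  ultimately show False by simp
qed

lemma cmod_cinner_le: "cmod (cinner x y) \<le> norm x * norm y"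
proof (cases "y = 0")
  case False
  let ?c = "cinner x y" and ?n = "(norm y)\<^sup>2"
  have n: "?n > 0" using False by simp
  have "0 \<le> (norm (x - (?c / of_real ?n) *\<^sub>C y))\<^sup>2" by simp
  also have "\<dots> = (norm x)\<^sup>2 - (cmod ?c)\<^sup>2 / ?n"
  proof -
    have "Re (cinner x ((?c / of_real ?n) *\<^sub>C y)) = (cmod ?c)\<^sup>2 / ?n"
      by (simp add: cinner_linear cmod_mult_self power2_eq_square algebra_simps add_divide_distrib
          flip: of_real_mult)
    moreover have "(norm ((?c / of_real ?n) *\<^sub>C y))\<^sup>2 = (cmod ?c)\<^sup>2 / ?n"
      using n by (simp add: norm_scaleC norm_divide norm_mult power_mult_distrib power_divide power2_eq_square)
    ultimately show ?thesis by (simp add: norm_diff_sq)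
  qed
  finally have "(cmod ?c)\<^sup>2 \<le> (norm x * norm y)\<^sup>2"
    using n by (simp add: power_mult_distrib field_simps)
  then show ?thesis
    by (simp add: power2_le_iff_abs_le)
qed simp

lemma bounded_bilinear_cinner: "bounded_bilinear (cinner :: 'a::complex_hilbert \<Rightarrow> 'a \<Rightarrow> complex)"
proof
  show "\<exists>K. \<forall>a b. norm (cinner a b) \<le> norm a * norm b * K"
    by (rule exI[of _ 1]) (simp add: cmod_cinner_le)
qed (simp_all add: cinner_linear scaleR_scaleC[where 'a='a] scaleR_conv_of_real)

lemmas tendsto_cinner [tendsto_intros] = bounded_bilinear.tendsto[OF bounded_bilinear_cinner]
lemmas continuous_on_cinner [continuous_intros] =
  bounded_bilinear.continuous_on[OF bounded_bilinear_cinner]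

lemma bounded_linear_scaleC: "bounded_linear (\<lambda>x. a *\<^sub>C x)"
proof
  show "\<exists>K. \<forall>x. norm (a *\<^sub>C x) \<le> norm x * K"
    by (rule exI[of _ "cmod a"]) (simp add: norm_scaleC mult.commute)
qed (simp_all add: scaleC_add_right scaleR_scaleC scaleC_scaleC mult.commute)

lemmas tendsto_scaleC [tendsto_intros] = bounded_linear.tendsto[OF bounded_linear_scaleC]

section \<open>Orthogonal complements, projection and Riesz representation\<close>

lemma closed_ortho_compl: "closed (ortho_compl M)"
proof -
  have "ortho_compl M = (\<Inter>m\<in>M. {x. cinner x m = 0})"
    by (auto simp: ortho_compl_def)
  then show ?thesis
    by (auto intro!: closed_Collect_eq continuous_intros)
qed

lemma csubspace_ortho_compl: "csubspace (ortho_compl M)"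
  by (auto simp: complex_vector.subspace_def ortho_compl_def cinner_linear)

lemma csubspace_closure:
  assumes "csubspace V"
  shows "csubspace (closure V)"
proof -
  have V: "0 \<in> V" "\<And>x y. x \<in> V \<Longrightarrow> y \<in> V \<Longrightarrow> x + y \<in> V" "\<And>x a. x \<in> V \<Longrightarrow> a *\<^sub>C x \<in> V"
    using assms by (auto simp: complex_vector.subspace_def)
  have "x + y \<in> closure V" if xy: "x \<in> closure V" "y \<in> closure V" for x y
  proof -
    obtain u v where "\<And>n. u n \<in> V" "u \<longlonglongrightarrow> x" "\<And>n. v n \<in> V" "v \<longlonglongrightarrow> y"
      using xy unfolding closure_sequential by blast
    then show ?thesis
      unfolding closure_sequential by (intro exI[of _ "\<lambda>n. u n + v n"]) (auto intro!: tendsto_add V)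
  qed
  moreover have "a *\<^sub>C x \<in> closure V" if x: "x \<in> closure V" for a x
  proof -
    obtain u where "\<And>n. u n \<in> V" "u \<longlonglongrightarrow> x"
      using x unfolding closure_sequential by blast
    then show ?thesis
      unfolding closure_sequential
      by (intro exI[of _ "\<lambda>n. a *\<^sub>C u n"]) (auto intro!: tendsto_scaleC V)
  qed
  ultimately show ?thesis
    using V(1) closure_subset[of V] by (auto simp: complex_vector.subspace_def)
qed

text \<open>The parallelogram law for w - x and w - y. When x and y nearly minimize the distance
  from w to a subspace, the midpoint is no closer than the infimum, so the right-hand side is small
  and a minimizing sequence is Cauchy.\<close>

lemma norm_halves_sq:
  fixes x y w :: "'a::complex_hilbert"
  shows "(norm (x - y))\<^sup>2 = 2 * (norm (w - x))\<^sup>2 + 2 * (norm (w - y))\<^sup>2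
     - 4 * (norm (w - (1/2) *\<^sub>R (x + y)))\<^sup>2"
proof -
  have "(w - x) + (w - y) = 2 *\<^sub>R (w - (1/2) *\<^sub>R (x + y))"
    by (simp add: algebra_simps scaleR_2)
  then have "(norm ((w - x) + (w - y)))\<^sup>2 = 4 * (norm (w - (1/2) *\<^sub>R (x + y)))\<^sup>2"
    by (simp add: power_mult_distrib)
  then show ?thesis
    using norm_add_sq[of "w - x" "w - y"] norm_diff_sq[of "w - x" "w - y"]
    by (simp add: norm_minus_commute)
qed

lemma ortho_projection_exists:
  fixes V :: "'a::complex_hilbert set"
  assumes V: "csubspace V" "closed V"
  shows "\<exists>v\<in>V. w - v \<in> ortho_compl V"
proof -
  have V0: "0 \<in> V" using V(1) complex_vector.subspace_0 by blast
  define d where "d = infdist w V"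
  have d: "d \<ge> 0" "\<And>v. v \<in> V \<Longrightarrow> d \<le> norm (w - v)"
    using infdist_le[of _ V w] by (auto simp: d_def infdist_nonneg dist_norm)
  have "\<exists>v\<in>V. (norm (w - v))\<^sup>2 < d\<^sup>2 + e" if "e > 0" for e
  proof -
    have "d < sqrt (d\<^sup>2 + e)" using d(1) that by (intro real_less_rsqrt) simp
    then have "\<exists>v\<in>V. dist w v < sqrt (d\<^sup>2 + e)"
      using infdist_attains_inf V0 cInf_lessD[of "dist w ` V"] by (auto simp: d_def infdist_def split: if_splits)
    then obtain v where "v \<in> V" "norm (w - v) < sqrt (d\<^sup>2 + e)" by (auto simp: dist_norm)
    then have "(norm (w - v))\<^sup>2 < (sqrt (d\<^sup>2 + e))\<^sup>2"
      by (intro power_strict_mono) auto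
    then show ?thesis using \<open>v \<in> V\<close> d that by auto
  qed
  then have "\<forall>n. \<exists>v. v \<in> V \<and> (norm (w - v))\<^sup>2 < d\<^sup>2 + inverse (real (Suc n))"
    by (metis inverse_positive_iff_positive of_nat_0_less_iff zero_less_Suc)
  then obtain v where v: "\<And>n. v n \<in> V" "\<And>n. (norm (w - v n))\<^sup>2 < d\<^sup>2 + inverse (real (Suc n))"
    by metis
  have half: "(1/2) *\<^sub>R (x + y) \<in> V" if "x \<in> V" "y \<in> V" for x y
    using V(1) that
    unfolding scaleR_scaleC by (intro complex_vector.subspace_add complex_vector.subspace_scale)
  have diff: "(norm (v m - v n))\<^sup>2 < 2 * inverse (real (Suc m)) + 2 * inverse (real (Suc n))" for m n
  proof -
    have "d\<^sup>2 \<le> (norm (w - (1/2) *\<^sub>R (v m + v n)))\<^sup>2"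
      using d half v(1) by (intro power_mono) auto
    then show ?thesis using v(2)[of m] v(2)[of n] norm_halves_sq[of "v m" "v n" w] by linarith
  qed
  have "Cauchy v"
  proof (rule metric_CauchyI)
    fix e :: real assume e: "0 < e"
    obtain N where N: "inverse (real (Suc N)) < e\<^sup>2 / 4"
      using reals_Archimedean[of "e\<^sup>2/4"] e by auto
    have "dist (v m) (v n) < e" if "m \<ge> N" "n \<ge> N" for m n
    proof -
      have "inverse (real (Suc m)) \<le> inverse (real (Suc N))" "inverse (real (Suc n)) \<le> inverse (real (Suc N))"
        using that by (auto intro!: le_imp_inverse_le)
      then have "(norm (v m - v n))\<^sup>2 < e\<^sup>2" using diff[of m n] N by linarith
      then show ?thesis using e power_less_imp_less_base[of "norm (v m - v n)" 2 e] by (simp add: dist_norm)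
    qed
    then show "\<exists>M. \<forall>m\<ge>M. \<forall>n\<ge>M. dist (v m) (v n) < e" by blast
  qed
  then obtain l where l: "v \<longlonglongrightarrow> l" using Cauchy_convergent convergent_def by blast
  have lV: "l \<in> V" using V(2) v(1) l closed_sequentially by blast
  have "(\<lambda>n. (norm (w - v n))\<^sup>2) \<longlonglongrightarrow> (norm (w - l))\<^sup>2" by (intro tendsto_intros l)
  moreover have "(\<lambda>n. d\<^sup>2 + inverse (real (Suc n))) \<longlonglongrightarrow> d\<^sup>2 + 0"
    by (intro tendsto_intros LIMSEQ_inverse_real_of_nat)
  ultimately have "(norm (w - l))\<^sup>2 \<le> d\<^sup>2 + 0"
    using v(2) by (intro LIMSEQ_le[of "\<lambda>n. (norm (w - v n))\<^sup>2"]) (auto intro: less_imp_le)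
  then have min: "(norm (w - l))\<^sup>2 \<le> (norm (w - p))\<^sup>2" if "p \<in> V" for p
    using power_mono[OF d(2)[OF that] d(1), of 2] by linarith
  have "cinner (w - l) p = 0" if p: "p \<in> V" for p
  proof (rule norm_sub_proj_sq[OF refl])
    let ?a = "complex_of_real (1 / ((norm p)\<^sup>2 + 1)) * cinner (w - l) p"
    have "l + ?a *\<^sub>C p \<in> V"
      using V(1) lV p by (simp add: complex_vector.subspace_add complex_vector.subspace_scale)
    from min[OF this] show "(norm (w - l))\<^sup>2 \<le> (norm (w - l - ?a *\<^sub>C p))\<^sup>2"
      by (simp add: algebra_simps)
  qed
  then show ?thesis using lV by (auto simp: ortho_compl_def)
qed

lemma ortho_compl_ortho_compl:
  assumes "csubspace V"
  shows "ortho_compl (ortho_compl V) = closure V"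
proof (rule antisym)
  have "V \<subseteq> ortho_compl (ortho_compl V)"
    by (auto simp: ortho_compl_def) (metis cinner_commute complex_cnj_zero)
  then show "closure V \<subseteq> ortho_compl (ortho_compl V)"
    by (simp add: closed_ortho_compl closure_minimal)
  show "ortho_compl (ortho_compl V) \<subseteq> closure V"
  proof
    fix w assume w: "w \<in> ortho_compl (ortho_compl V)"
    obtain v where v: "v \<in> closure V" "w - v \<in> ortho_compl (closure V)"
      using ortho_projection_exists[OF csubspace_closure[OF assms] closed_closure] by blast
    have "w - v \<in> ortho_compl V"
      using v(2) closure_subset[of V] by (auto simp: ortho_compl_def)
    then have "cinner w (w - v) = 0" using w by (auto simp: ortho_compl_def)
    moreover have "cinner (w - v) v = 0" using v by (auto simp: ortho_compl_def)
    then have "cinner v (w - v) = 0" using cinner_commute[of v "w - v"] by simp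
    ultimately have "cinner (w - v) (w - v) = 0" by (simp add: cinner_diff_left)
    then show "w \<in> closure V" using v(1) by simp
  qed
qed

text \<open>Linearity and the bound are asked for on V alone, since the functional of interest is
  given by a form and makes sense only on a graph. The representing vector is a multiple of the part
  e of x orthogonal to the kernel, scaled so that it gives the right value at e.\<close>

lemma riesz_on_subspace:
  fixes V :: "'a::complex_hilbert set" and f :: "'a \<Rightarrow> complex"
  assumes V: "csubspace V" "closed V"
    and add: "\<And>x y. x \<in> V \<Longrightarrow> y \<in> V \<Longrightarrow> f (x + y) = f x + f y"
    and scale: "\<And>a x. x \<in> V \<Longrightarrow> f (a *\<^sub>C x) = a * f x"
    and bound: "\<And>x. x \<in> V \<Longrightarrow> cmod (f x) \<le> c * norm x"
  shows "\<exists>z\<in>V. \<forall>x\<in>V. f x = cinner x z"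
proof (cases "\<forall>x\<in>V. f x = 0")
  case True
  then show ?thesis using V(1) complex_vector.subspace_0 by force
next
  case False
  then obtain x where x: "x \<in> V" "f x \<noteq> 0" by blast
  define N where "N = {x\<in>V. f x = 0}"
  have V0: "0 \<in> V" using V(1) complex_vector.subspace_0 by blast
  have f0: "f 0 = 0" using scale[OF V0, of 0] by simp
  have diff: "f (x - y) = f x - f y" if "x \<in> V" "y \<in> V" for x y
    using add[of x "(- 1) *\<^sub>C y"] scale[of y "-1"] that V(1)
    by (simp add: complex_vector.subspace_scale complex_vector.subspace_neg)
  have "csubspace N"
    using V(1) add scale f0 by (auto simp: N_def complex_vector.subspace_def)
  moreover have "closed N"
    unfolding closed_sequential_limits
  proof (intro allI impI, elim conjE)
    fix u l assume u: "\<forall>n. u n \<in> N" "u \<longlonglongrightarrow> l"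
    then have l: "l \<in> V" using V(2) closed_sequentially[of V u l] by (auto simp: N_def)
    have "norm (f l) \<le> c * norm (l - u n)" for n
      using bound[of "l - u n"] diff[of l "u n"] u(1) l V(1)
      by (auto simp: N_def complex_vector.subspace_diff)
    moreover have "(\<lambda>n. c * norm (l - u n)) \<longlonglongrightarrow> c * norm (l - l)"
      by (intro tendsto_intros u(2))
    ultimately have "norm (f l) \<le> c * norm (l - l)"
      by (intro LIMSEQ_le_const) auto
    then show "l \<in> N" using l by (simp add: N_def)
  qed
  ultimately obtain p where p: "p \<in> N" "x - p \<in> ortho_compl N"
    using ortho_projection_exists by blast
  define e where "e = x - p"
  have e: "e \<in> V" "f e \<noteq> 0"
    using p x V(1) diff by (auto simp: e_def N_def complex_vector.subspace_diff)
  have e0: "cinner e e \<noteq> 0" using e f0 by auto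
  define z where "z = cnj (f e / cinner e e) *\<^sub>C e"
  have "f y = cinner y z" if y: "y \<in> V" for y
  proof -
    let ?q = "y - (f y / f e) *\<^sub>C e"
    have "f ?q = 0" using y e V(1) by (simp add: diff scale complex_vector.subspace_scale)
    then have "?q \<in> N" using y e V(1)
      by (simp add: N_def complex_vector.subspace_diff complex_vector.subspace_scale)
    then have "cinner e ?q = 0" using p(2) by (auto simp: e_def ortho_compl_def)
    then have "cinner ?q e = 0" using cinner_commute[of ?q e] by simp
    then have "cinner y e = f y / f e * cinner e e" by (simp add: cinner_linear)
    then show ?thesis using e e0 by (simp add: z_def cinner_linear)
  qed
  moreover have "z \<in> V" using e V(1) by (simp add: z_def complex_vector.subspace_scale)
  ultimately show ?thesis by blast
qed


section \<open>Adjoints and operator parts\<close>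

lemma adjoint_rel_iff: "(k, h) \<in> adjoint_rel T \<longleftrightarrow> (\<forall>f f'. (f, f') \<in> T \<longrightarrow> cinner k f' = cinner h f)"
  by (auto simp: adjoint_rel_def)

text \<open>Up to the flip {k, h} to {-h, k}, the adjoint is an orthogonal complement in the product
  space. Closedness of adjoints and T^** = closure of T are thereby inherited from
  complements.\<close>

lemma adjoint_rel_iff_ortho: "(k, h) \<in> adjoint_rel T \<longleftrightarrow> (- h, k) \<in> ortho_compl T"
  by (force simp: adjoint_rel_iff ortho_compl_def cinner_prod_def)

lemma csubspace_rel_iff:
  "csubspace T \<longleftrightarrow> (0, 0) \<in> T
    \<and> (\<forall>f f' g g'. (f, f') \<in> T \<longrightarrow> (g, g') \<in> T \<longrightarrow> (f + g, f' + g') \<in> T)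
    \<and> (\<forall>a f f'. (f, f') \<in> T \<longrightarrow> (a *\<^sub>C f, a *\<^sub>C f') \<in> T)"
  by (simp add: complex_vector.subspace_def scaleC_prod_def zero_prod_def Ball_def split_paired_All)

lemma csubspace_adjoint_rel: "csubspace (adjoint_rel T)"
  by (auto simp: csubspace_rel_iff adjoint_rel_iff cinner_linear)

lemma closed_adjoint_rel: "closed (adjoint_rel T)"
proof -
  have "adjoint_rel T = (\<lambda>p. (- snd p, fst p)) -` ortho_compl T"
    by (auto simp: adjoint_rel_iff_ortho)
  then show ?thesis
    by (auto intro!: closed_vimage closed_ortho_compl continuous_intros)
qed

lemma adjoint_rel_adjoint_rel:
  assumes "csubspace T"
  shows "adjoint_rel (adjoint_rel T) = closure T"
proof -
  have "(f, g) \<in> adjoint_rel (adjoint_rel T) \<longleftrightarrow> (f, g) \<in> ortho_compl (ortho_compl T)" for f g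
  proof -
    have "(f, g) \<in> ortho_compl (ortho_compl T)
      \<longleftrightarrow> (\<forall>h k. (- h, k) \<in> ortho_compl T \<longrightarrow> cinner f (- h) + cinner g k = 0)"
    proof (intro iffI allI impI)
      assume *: "\<forall>h k. (- h, k) \<in> ortho_compl T \<longrightarrow> cinner f (- h) + cinner g k = 0"
      have "cinner f a + cinner g b = 0" if "(a, b) \<in> ortho_compl T" for a b
        using *[rule_format, of "- a" b] that by simp
      then show "(f, g) \<in> ortho_compl (ortho_compl T)"
        by (auto simp: ortho_compl_def[of "ortho_compl T"] cinner_prod_def)
    next
      fix h k assume "(f, g) \<in> ortho_compl (ortho_compl T)" "(- h, k) \<in> ortho_compl T"
      then show "cinner f (- h) + cinner g k = 0"
        unfolding ortho_compl_def[of "ortho_compl T"] by (force simp: cinner_prod_def)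
    qed
    also have "\<dots> \<longleftrightarrow> (f, g) \<in> adjoint_rel (adjoint_rel T)"
      unfolding adjoint_rel_iff[of f g "adjoint_rel T"] unfolding adjoint_rel_iff_ortho by auto
    finally show ?thesis by blast
  qed
  then show ?thesis using ortho_compl_ortho_compl[OF assms] by auto
qed

lemma adjoint_rel_closure: "adjoint_rel (closure T) = adjoint_rel T"
proof -
  have "ortho_compl (closure T) = ortho_compl T"
  proof
    show "ortho_compl (closure T) \<subseteq> ortho_compl T"
      using closure_subset by (auto simp: ortho_compl_def)
    show "ortho_compl T \<subseteq> ortho_compl (closure T)"
    proof
      fix x assume "x \<in> ortho_compl T"
      then have "T \<subseteq> {y. cinner x y = 0}" by (auto simp: ortho_compl_def)
      then have "closure T \<subseteq> {y. cinner x y = 0}"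
        by (rule closure_minimal) (auto intro!: closed_Collect_eq continuous_intros)
      then show "x \<in> ortho_compl (closure T)" by (auto simp: ortho_compl_def)
    qed
  qed
  then show ?thesis by (simp add: set_eq_iff split_paired_all adjoint_rel_iff_ortho)
qed

lemma rel_mul_adjoint_rel: "rel_mul (adjoint_rel T) = ortho_compl (Domain T)"
  by (auto simp: rel_mul_def adjoint_rel_iff ortho_compl_def)

lemma csubspace_Domain: "csubspace T \<Longrightarrow> csubspace (Domain T)"
  by (auto simp: complex_vector.subspace_def zero_prod_def Domain_iff scaleC_prod_def) force+

text \<open>The multivalued part of T^* is the complement of dom T, so orthogonality to it means
  membership in the closure of dom T.\<close>

lemma operator_part_adjoint_rel:
  assumes "csubspace T"
  shows "operator_part (adjoint_rel T) = {(f, g) \<in> adjoint_rel T. g \<in> closure (Domain T)}"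
  by (simp add: operator_part_def rel_mul_adjoint_rel ortho_compl_ortho_compl
      csubspace_Domain assms)

lemma csubspace_operator_part:
  assumes "csubspace R"
  shows "csubspace (operator_part R)"
  using assms csubspace_ortho_compl[of "rel_mul R"]
  by (auto simp: csubspace_rel_iff complex_vector.subspace_def[of "ortho_compl _"] operator_part_def)

lemma single_valued_operator_part:
  assumes "csubspace R"
  shows "single_valued (operator_part R)"
proof (rule single_valuedI)
  fix x y z assume *: "(x, y) \<in> operator_part R" "(x, z) \<in> operator_part R"
  then have "(x, y) - (x, z) \<in> R"
    using assms by (intro complex_vector.subspace_diff) (auto simp: operator_part_def)
  then have "y - z \<in> rel_mul R" by (simp add: rel_mul_def)
  moreover have "y - z \<in> ortho_compl (rel_mul R)"
    using * by (auto simp: operator_part_def csubspace_ortho_compl complex_vector.subspace_diff)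
  ultimately have "cinner (y - z) (y - z) = 0" by (auto simp: ortho_compl_def)
  then show "y = z" by simp
qed

lemma closed_operator_part:
  assumes "closed R"
  shows "closed (operator_part R)"
proof -
  have "operator_part R = R \<inter> snd -` ortho_compl (rel_mul R)"
    by (auto simp: operator_part_def)
  then show ?thesis
    using assms by (auto intro!: closed_Int closed_vimage closed_ortho_compl continuous_intros)
qed

lemma csubspace_rel_restrict:
  assumes "csubspace T" "csubspace L"
  shows "csubspace (rel_restrict T L)"
  using assms by (auto simp: csubspace_rel_iff complex_vector.subspace_def[of L] rel_restrict_def)


section \<open>The operator I + iB\<close>

locale bounded_symmetric =
  fixes B :: "'b::complex_hilbert \<Rightarrow> 'b"
  assumes bounded: "bounded_linear B"
    and symmetric: "cinner (B x) y = cinner x (B y)"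
begin

abbreviation C :: "'b \<Rightarrow> 'b" where "C \<equiv> one_plus_i B"

text \<open>\<open>bounded_linear\<close> speaks of real scalars; complex homogeneity follows from
  symmetry by pairing the defect with itself.\<close>

lemma B_scaleC: "B (a *\<^sub>C x) = a *\<^sub>C B x"
proof -
  let ?d = "B (a *\<^sub>C x) - a *\<^sub>C B x"
  have "cinner (B (a *\<^sub>C x)) ?d = cinner (a *\<^sub>C B x) ?d"
    by (simp only: symmetric cinner_scaleC_left)
  then have "cinner ?d ?d = 0" by (simp add: cinner_diff_left)
  then show ?thesis by simp
qed

lemma cnj_cinner_B: "cnj (cinner (B x) x) = cinner (B x) x"
  by (metis cinner_commute symmetric)

lemma Im_cinner_B: "Im (cinner (B x) x) = 0"
  using cnj_cinner_B[of x] by (metis Reals_cnj_iff complex_is_Real_iff)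

lemma C_add: "C (x + y) = C x + C y"
  by (simp add: one_plus_i_def scaleC_add_right linear_add bounded_linear.linear bounded)

lemma C_scaleC: "C (a *\<^sub>C x) = a *\<^sub>C C x"
  by (simp add: one_plus_i_def scaleC_add_right scaleC_scaleC B_scaleC mult.commute)

lemma bounded_linear_C: "bounded_linear C"
  unfolding one_plus_i_def
  by (intro bounded_linear_add bounded_linear_ident bounded_linear_compose[OF bounded_linear_scaleC bounded])

lemma C_diff: "C (x - y) = C x - C y"
  by (rule linear_diff[OF bounded_linear.linear[OF bounded_linear_C]])

lemma C_zero [simp]: "C 0 = 0"
  by (rule linear_0[OF bounded_linear.linear[OF bounded_linear_C]])

lemmas tendsto_C [tendsto_intros] = bounded_linear.tendsto[OF bounded_linear_C]

lemma Re_cinner_C: "Re (cinner (C x) x) = (norm x)\<^sup>2"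
  by (simp add: one_plus_i_def cinner_linear Im_cinner_B power2_norm_eq_cinner)

text \<open>B contributes only to the imaginary part, so |x|^2 = Re (C x, x) \<le> |C x| |x|. This
  allows convergence of C j_n to be pulled back to j_n.\<close>

lemma norm_le_norm_C: "norm x \<le> norm (C x)"
proof (cases "x = 0")
  case False
  have "norm x * norm x = Re (cinner (C x) x)" by (simp add: Re_cinner_C power2_eq_square)
  also have "\<dots> \<le> norm (C x) * norm x"
    using complex_Re_le_cmod cmod_cinner_le order_trans by blast
  finally show ?thesis using False by simp
qed simp

text \<open>Translates the Cauchy condition in \<open>form_conv\<close> into norm convergence of the
  vectors that represent the form: (C x, x) and |x|^2 bound each other up to a constant.\<close>

lemma Cauchy_iff_C:
  "Cauchy h \<longleftrightarrow>
    (\<forall>e>0. \<exists>N. \<forall>m\<ge>N. \<forall>n\<ge>N. cmod (cinner (C (h n - h m)) (h n - h m)) < e)" (is "?l \<longleftrightarrow> ?r")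
proof
  assume h: ?l
  obtain k where k: "k > 0" "\<And>x. norm (C x) \<le> norm x * k"
    using bounded_linear.pos_bounded[OF bounded_linear_C] by blast
  show ?r
  proof (intro allI impI)
    fix e :: real assume e: "e > 0"
    obtain N where N: "\<And>m n. m \<ge> N \<Longrightarrow> n \<ge> N \<Longrightarrow> norm (h m - h n) < sqrt (e / k)"
      using e k(1) CauchyD[OF h, of "sqrt (e / k)"] by auto
    have "cmod (cinner (C (h n - h m)) (h n - h m)) < e" if "m \<ge> N" "n \<ge> N" for m n
    proof -
      let ?d = "h n - h m"
      have "cmod (cinner (C ?d) ?d) \<le> norm (C ?d) * norm ?d" by (rule cmod_cinner_le)
      also have "\<dots> \<le> (norm ?d * k) * norm ?d" using k(2) by (intro mult_right_mono) auto
      also have "\<dots> = k * (norm ?d)\<^sup>2" by (simp add: power2_eq_square)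
      also have "\<dots> < k * (sqrt (e / k))\<^sup>2"
        using N[OF that(2,1)] k(1) by (intro mult_strict_left_mono power_strict_mono) auto
      also have "\<dots> = e" using e k(1) by simp
      finally show ?thesis .
    qed
    then show "\<exists>N. \<forall>m\<ge>N. \<forall>n\<ge>N. cmod (cinner (C (h n - h m)) (h n - h m)) < e" by blast
  qed
next
  assume h: ?r
  show ?l
  proof (rule metric_CauchyI)
    fix e :: real assume e: "e > 0"
    obtain N where N: "\<And>m n. m \<ge> N \<Longrightarrow> n \<ge> N \<Longrightarrow> cmod (cinner (C (h n - h m)) (h n - h m)) < e\<^sup>2"
      using h[rule_format, of "e\<^sup>2"] e by auto
    have "dist (h m) (h n) < e" if "m \<ge> N" "n \<ge> N" for m n
    proof -
      have "(norm (h m - h n))\<^sup>2 < e\<^sup>2"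
        using complex_Re_le_cmod[of "cinner (C (h m - h n)) (h m - h n)"] N[OF that(2,1)]
        by (simp add: Re_cinner_C)
      then show ?thesis using e power_less_imp_less_base[of "norm (h m - h n)" 2 e] by (simp add: dist_norm)
    qed
    then show "\<exists>M. \<forall>m\<ge>M. \<forall>n\<ge>M. dist (h m) (h n) < e" by blast
  qed
qed

lemma Im_cinner_C_le:
  obtains m where "m \<ge> 0" "\<And>x. \<bar>Im (cinner (C x) x)\<bar> \<le> m * (norm x)\<^sup>2"
proof -
  obtain m where m: "m \<ge> 0" "\<And>x. norm (B x) \<le> norm x * m"
    using bounded_linear.nonneg_bounded[OF bounded] by blast
  have "\<bar>Im (cinner (C x) x)\<bar> \<le> m * (norm x)\<^sup>2" for x
  proof -
    have "\<bar>Im (cinner (C x) x)\<bar> = \<bar>Re (cinner (B x) x)\<bar>"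
      by (simp add: one_plus_i_def cinner_linear cinner_self)
    also have "\<dots> \<le> norm (B x) * norm x"
      using abs_Re_le_cmod cmod_cinner_le order_trans by blast
    also have "\<dots> \<le> (norm x * m) * norm x" using m by (intro mult_right_mono) auto
    finally show ?thesis by (simp add: power2_eq_square algebra_simps)
  qed
  then show ?thesis using that m by blast
qed

lemma C_sectorial:
  obtains \<alpha> where "0 \<le> \<alpha>" "\<alpha> < pi / 2" "\<And>x. in_sector \<alpha> (cinner (C x) x)"
proof -
  obtain m where m: "m \<ge> 0" "\<And>x. \<bar>Im (cinner (C x) x)\<bar> \<le> m * (norm x)\<^sup>2"
    using Im_cinner_C_le by blast
  show ?thesis
  proof (rule that[of "arctan m"])
    show "0 \<le> arctan m" "arctan m < pi / 2" using m arctan_bounded[of m] by auto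
    show "in_sector (arctan m) (cinner (C x) x)" for x
      using m(2)[of x] by (simp add: in_sector_def Re_cinner_C tan_arctan)
  qed
qed

text \<open>Lax--Milgram on a closed subspace, by iterating the strict contraction
  \<open>v \<mapsto> v + \<tau> P (w - C v)\<close>, where \<open>P\<close> is the orthogonal projection onto \<open>V\<close> and \<open>\<tau>\<close> is small.\<close>

lemma lax_milgram:
  assumes V: "csubspace V" "closed V"
  shows "\<exists>v\<in>V. w - C v \<in> ortho_compl V"
proof -
  define P where "P = (\<lambda>w. SOME v. v \<in> V \<and> w - v \<in> ortho_compl V)"
  have P: "P w \<in> V" "w - P w \<in> ortho_compl V" for w
    using someI_ex[of "\<lambda>v. v \<in> V \<and> w - v \<in> ortho_compl V"] ortho_projection_exists[OF V, of w]
    by (auto simp: P_def)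
  have P_cinner: "cinner (P w) v = cinner w v" if "v \<in> V" for w v
    using P(2)[of w] that by (auto simp: ortho_compl_def cinner_diff_left)
  obtain m0 where m0: "\<And>x. norm (C x) \<le> norm x * m0"
    using bounded_linear.bounded[OF bounded_linear_C] by blast
  define m where "m = max 1 m0"
  have m: "m \<ge> 1" "\<And>x. norm (C x) \<le> norm x * m"
    using m0 by (auto simp: m_def intro: order_trans[OF m0 mult_left_mono])
  \<comment> \<open>From Re (C d, d) = |d|^2 and |C d| \<le> m |d|, one iteration multiplies the
    squared distance by at most 1 - 2 \<tau> + \<tau>^2 m^2. This is smallest at \<tau> = 1/m^2,
    where it equals 1 - \<tau>; taking m \<ge> 1 keeps \<tau> \<le> 1.\<close>
  define \<tau> where "\<tau> = 1 / m\<^sup>2"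
  define F where "F v = v + \<tau> *\<^sub>R P (w - C v)" for v
  define c where "c = sqrt (1 - \<tau>)"
  have \<tau>: "0 < \<tau>" "\<tau> \<le> 1" "\<tau> * m\<^sup>2 = 1" using m(1) by (auto simp: \<tau>_def divide_simps)
  have contr: "dist (F x) (F y) \<le> c * dist x y" if xy: "x \<in> V" "y \<in> V" for x y
  proof -
    let ?d = "x - y"
    let ?q = "P (w - C y) - P (w - C x)"
    have d: "?d \<in> V" using V(1) xy by (rule complex_vector.subspace_diff)
    have qV: "?q \<in> V" using V(1) P(1) P(1) by (rule complex_vector.subspace_diff)
    have q: "cinner ?q v = cinner (C ?d) v" if "v \<in> V" for v
      using that by (simp add: cinner_diff_left P_cinner C_diff)
    have "(norm ?q)\<^sup>2 \<le> norm (C ?d) * norm ?q"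
      using q[OF qV] complex_Re_le_cmod[of "cinner (C ?d) ?q"] cmod_cinner_le[of "C ?d" ?q]
      by (simp add: power2_norm_eq_cinner)
    then have "norm ?q \<le> norm (C ?d)"
      by (cases "?q = 0") (simp_all add: power2_eq_square)
    then have "norm ?q \<le> norm ?d * m" using m(2) order_trans by blast
    then have nq: "(norm ?q)\<^sup>2 \<le> (norm ?d)\<^sup>2 * m\<^sup>2"
      using power_mono[of "norm ?q" "norm ?d * m" 2] by (simp add: power_mult_distrib)
    have "F x - F y = ?d - \<tau> *\<^sub>R ?q" by (simp add: F_def algebra_simps)
    then have "(norm (F x - F y))\<^sup>2 = (norm ?d)\<^sup>2 - 2 * \<tau> * Re (cinner ?d ?q) + \<tau>\<^sup>2 * (norm ?q)\<^sup>2"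
      using norm_diff_sq[of ?d "\<tau> *\<^sub>R ?q"]
      by (simp add: scaleR_scaleC cinner_scaleC_right norm_scaleC power_mult_distrib)
    also have "Re (cinner ?d ?q) = (norm ?d)\<^sup>2"
      using q[OF d] by (metis Re_cinner_commute Re_cinner_C)
    also have "\<tau>\<^sup>2 * (norm ?q)\<^sup>2 \<le> \<tau>\<^sup>2 * ((norm ?d)\<^sup>2 * m\<^sup>2)"
      using nq by (intro mult_left_mono) auto
    also have "\<tau>\<^sup>2 * ((norm ?d)\<^sup>2 * m\<^sup>2) = \<tau> * (norm ?d)\<^sup>2 * (\<tau> * m\<^sup>2)"
      by (simp add: power2_eq_square)
    finally have "(norm (F x - F y))\<^sup>2 \<le> (1 - \<tau>) * (norm ?d)\<^sup>2"
      unfolding \<tau>(3) by (simp add: algebra_simps)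
    also have "\<dots> = (c * norm ?d)\<^sup>2"
      using \<tau> by (simp add: c_def power_mult_distrib)
    finally show ?thesis
      using power2_le_imp_le[of "norm (F x - F y)" "c * norm ?d"] \<tau> by (simp add: dist_norm c_def)
  qed
  have "\<exists>!x\<in>V. F x = x"
  proof (rule Banach_fix)
    show "complete V" using V(2) by (simp add: complete_eq_closed)
    show "V \<noteq> {}" using V(1) complex_vector.subspace_0 by blast
    show "0 \<le> c" "c < 1" using \<tau> by (auto simp: c_def)
    show "F ` V \<subseteq> V"
      using V(1) P(1) unfolding F_def scaleR_scaleC
      by (auto intro!: complex_vector.subspace_add complex_vector.subspace_scale)
    show "\<And>x y. x \<in> V \<Longrightarrow> y \<in> V \<Longrightarrow> dist (F x) (F y) \<le> c * dist x y" using contr by blast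
  qed
  then obtain v where v: "v \<in> V" "F v = v" by blast
  then have "P (w - C v) = 0" using \<tau>(1) by (simp add: F_def)
  then show ?thesis using P(2)[of "w - C v"] v(1) by auto
qed

lemma bounded_symmetric_uminus: "bounded_symmetric (\<lambda>x. - B x)"
  by (rule bounded_symmetric.intro) (simp_all add: bounded_linear_minus bounded symmetric)

lemma cinner_C_left: "cinner (C x) y = cinner x (one_plus_i (\<lambda>x. - B x) y)"
  using cinner_scaleC_right[of x "\<i>" "- B y"] by (simp add: one_plus_i_def cinner_linear symmetric)

text \<open>The adjoint of I + iB is I - iB, so the dual problem is \<open>lax_milgram\<close> for
  -B.\<close>

lemma lax_milgram_adjoint:
  assumes V: "csubspace V" "closed V"
  shows "\<exists>v\<in>V. \<forall>x\<in>V. cinner (C x) v = cinner x w"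
proof -
  obtain v where "v \<in> V" "w - one_plus_i (\<lambda>x. - B x) v \<in> ortho_compl V"
    using bounded_symmetric.lax_milgram[OF bounded_symmetric_uminus V] by blast
  then have "cinner (one_plus_i (\<lambda>x. - B x) v) x = cinner w x" if "x \<in> V" for x
    using that by (simp add: ortho_compl_def cinner_diff_left)
  then have "cinner (C x) v = cinner x w" if "x \<in> V" for x
    using that cinner_C_left cinner_commute by metis
  then show ?thesis using \<open>v \<in> V\<close> by blast
qed

text \<open>A skew projection of w onto V: the error w - v is orthogonal to C V rather than to V. It
  is the dual problem with C^* w on the right.\<close>

lemma lax_milgram_projection:
  assumes "csubspace V" "closed V"
  shows "\<exists>v\<in>V. \<forall>x\<in>V. cinner (C x) v = cinner (C x) w"
  using lax_milgram_adjoint[OF assms, of "one_plus_i (\<lambda>x. - B x) w"]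
  by (auto simp flip: cinner_C_left)

text \<open>On a product, \<open>I + i (0 \<oplus> B)\<close> turns the form of an operator plus the inner product into a
  form on its graph.\<close>

lemma bounded_symmetric_prod: "bounded_symmetric (map_prod (\<lambda>_::'a::complex_hilbert. 0::'a) B)"
proof (rule bounded_symmetric.intro)
  have eq: "map_prod (\<lambda>_::'a. 0::'a) B = (\<lambda>p. (0, B (snd p)))" by (auto simp: fun_eq_iff)
  show "bounded_linear (map_prod (\<lambda>_::'a. 0::'a) B)"
    unfolding eq by (intro bounded_linear_Pair bounded_linear_zero
        bounded_linear_compose[OF bounded bounded_linear_snd])
qed (simp add: cinner_prod_def symmetric)

lemma one_plus_i_prod: "one_plus_i (map_prod (\<lambda>_. 0) B) (x, y) = (x, C y)"
  by (simp add: one_plus_i_def scaleC_prod_def)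

end


section \<open>Sectorial forms\<close>

lemma sesquilinear_formD:
  assumes "sesquilinear_form t" "x \<in> fdom t" "y \<in> fdom t" "z \<in> fdom t"
  shows "fval t (x + y) z = fval t x z + fval t y z" "fval t z (x + y) = fval t z x + fval t z y"
    "fval t (a *\<^sub>C x) y = a * fval t x y" "fval t x (a *\<^sub>C y) = cnj a * fval t x y"
    "fval t (x - y) z = fval t x z - fval t y z" "fval t z (x - y) = fval t z x - fval t z y"
proof -
  have D: "csubspace (fdom t)" using assms(1) by (simp add: sesquilinear_form_def)
  have *: "fval t (x + y) z = fval t x z + fval t y z" "fval t z (x + y) = fval t z x + fval t z y"
    "fval t (a *\<^sub>C x) y = a * fval t x y" "fval t x (a *\<^sub>C y) = cnj a * fval t x y"
    if "x \<in> fdom t" "y \<in> fdom t" "z \<in> fdom t" for x y z a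
    using assms(1) that by (auto simp: sesquilinear_form_def)
  show "fval t (x + y) z = fval t x z + fval t y z" "fval t z (x + y) = fval t z x + fval t z y"
    "fval t (a *\<^sub>C x) y = a * fval t x y" "fval t x (a *\<^sub>C y) = cnj a * fval t x y"
    using * assms by auto
  have "x - y \<in> fdom t" using D assms by (simp add: complex_vector.subspace_diff)
  then show "fval t (x - y) z = fval t x z - fval t y z" "fval t z (x - y) = fval t z x - fval t z y"
    using *(1)[of "x - y" y z] *(2)[of "x - y" y z] assms by auto
qed

lemma csubspace_fdom: "sesquilinear_form t \<Longrightarrow> csubspace (fdom t)"
  by (simp add: sesquilinear_form_def)

lemma sesquilinear_form_zero:
  assumes "sesquilinear_form t" "x \<in> fdom t"
  shows "fval t 0 x = 0"
proof -
  have "0 \<in> fdom t" using assms csubspace_fdom complex_vector.subspace_0 by blast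
  then show ?thesis using sesquilinear_formD(3)[of t 0 x x 0] assms by simp
qed

text \<open>A substitute for the Cauchy--Schwarz inequality of a sectorial form, from polarization and
  the parallelogram law for the real part.\<close>

lemma sectorial_form_bound:
  assumes t: "sectorial_form t"
  obtains c where "c \<ge> 0" "\<And>x y r. x \<in> fdom t \<Longrightarrow> y \<in> fdom t \<Longrightarrow> r > 0 \<Longrightarrow>
    cmod (fval t x y) \<le> c * (r * Re (fval t x x) + Re (fval t y y) / r)"
proof -
  have sq: "sesquilinear_form t" using t by (simp add: sectorial_form_def)
  note D = csubspace_fdom[OF sq]
  note mem = complex_vector.subspace_add[OF D] complex_vector.subspace_diff[OF D]
    complex_vector.subspace_scale[OF D]
  note exp = sesquilinear_formD[OF sq] mem
  obtain \<alpha> where \<alpha>: "0 \<le> \<alpha>" "\<alpha> < pi / 2" "\<And>x. x \<in> fdom t \<Longrightarrow> in_sector \<alpha> (fval t x x)"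
    using t by (auto simp: sectorial_form_def)
  define c where "c = 1 + tan \<alpha>"
  have c: "c \<ge> 0" using \<alpha> tan_gt_zero[of \<alpha>] by (cases "\<alpha> = 0") (auto simp: c_def)
  define q where "q x = Re (fval t x x)" for x
  have diag: "cmod (fval t x x) \<le> c * q x" if "x \<in> fdom t" for x
    using \<alpha>(3)[OF that] cmod_le[of "fval t x x"] by (simp add: in_sector_def c_def q_def algebra_simps)
  have unscaled: "cmod (fval t x y) \<le> c * (q x + q y)" if xy: "x \<in> fdom t" "y \<in> fdom t" for x y
  proof -
    let ?iy = "\<i> *\<^sub>C y"
    have iy: "?iy \<in> fdom t" using xy mem by blast
    have "4 * fval t x y = fval t (x + y) (x + y) - fval t (x - y) (x - y)
        + \<i> * (fval t (x + ?iy) (x + ?iy) - fval t (x - ?iy) (x - ?iy))"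
      using xy iy by (simp add: exp algebra_simps)
    then have "4 * cmod (fval t x y) = cmod (fval t (x + y) (x + y) - fval t (x - y) (x - y)
        + \<i> * (fval t (x + ?iy) (x + ?iy) - fval t (x - ?iy) (x - ?iy)))"
      by (metis norm_mult norm_numeral)
    also have "\<dots> \<le> cmod (fval t (x + y) (x + y) - fval t (x - y) (x - y))
        + cmod (fval t (x + ?iy) (x + ?iy) - fval t (x - ?iy) (x - ?iy))"
      by (rule order_trans[OF norm_triangle_ineq]) (simp add: norm_mult)
    also have "\<dots> \<le> (cmod (fval t (x + y) (x + y)) + cmod (fval t (x - y) (x - y)))
        + (cmod (fval t (x + ?iy) (x + ?iy)) + cmod (fval t (x - ?iy) (x - ?iy)))"
      by (intro add_mono norm_triangle_ineq4)
    also have "\<dots> \<le> (c * q (x + y) + c * q (x - y)) + (c * q (x + ?iy) + c * q (x - ?iy))"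
      using xy iy by (intro add_mono diag mem)
    also have "\<dots> = 4 * (c * (q x + q y))"
      using xy iy by (simp add: q_def exp algebra_simps)
    finally show ?thesis by simp
  qed
  have "cmod (fval t x y) \<le> c * (r * q x + q y / r)"
    if xy: "x \<in> fdom t" "y \<in> fdom t" and r: "r > 0" for x y r
  proof -
    \<comment> \<open>Stretching x by sqrt r and shrinking y by the same factor leaves t[x, y]
      unchanged and puts the weights r and 1/r on the diagonal values.\<close>
    let ?a = "complex_of_real (sqrt r)" and ?b = "complex_of_real (1 / sqrt r)"
    have aa: "?a * ?a = of_real r" "?b * ?b = of_real (1 / r)" "?a * ?b = 1"
      using r by (simp_all flip: of_real_mult)
    have "fval t (?a *\<^sub>C x) (?b *\<^sub>C y) = (?a * ?b) * fval t x y"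
      using xy by (simp add: exp)
    then have "cmod (fval t x y) \<le> c * (q (?a *\<^sub>C x) + q (?b *\<^sub>C y))"
      using unscaled[of "?a *\<^sub>C x" "?b *\<^sub>C y"] xy mem aa by simp
    also have "fval t (?a *\<^sub>C x) (?a *\<^sub>C x) = (?a * ?a) * fval t x x"
      using xy by (simp add: exp)
    then have "q (?a *\<^sub>C x) = r * q x" unfolding aa q_def by simp
    also have "fval t (?b *\<^sub>C y) (?b *\<^sub>C y) = (?b * ?b) * fval t y y"
      using xy by (simp add: exp)
    then have "q (?b *\<^sub>C y) = q y / r" unfolding aa q_def by simp
    finally show ?thesis .
  qed
  then show ?thesis using that[OF c] by (simp add: q_def)
qed

text \<open>In \<open>sectorial_form_bound\<close> the weight r is first taken so large that the
  term with the fixed y is below e; for this r the other term tends to 0.\<close>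

lemma sectorial_form_tendsto_0:
  assumes t: "sectorial_form t" and u: "\<And>n. u n \<in> fdom t" and y: "y \<in> fdom t"
    and lim: "(\<lambda>n. fval t (u n) (u n)) \<longlonglongrightarrow> 0"
  shows "(\<lambda>n. fval t (u n) y) \<longlonglongrightarrow> 0"
proof -
  obtain c where c: "c \<ge> 0" "\<And>x y r. x \<in> fdom t \<Longrightarrow> y \<in> fdom t \<Longrightarrow> r > 0 \<Longrightarrow>
    cmod (fval t x y) \<le> c * (r * Re (fval t x x) + Re (fval t y y) / r)"
    using sectorial_form_bound[OF t] by blast
  let ?k = "c * Re (fval t y y)"
  show ?thesis
  proof (rule tendstoI)
    fix e :: real assume e: "e > 0"
    define r where "r = 2 * (\<bar>?k\<bar> + 1) / e"
    have r: "r > 0" "?k / r < e"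
      using e abs_ge_self[of ?k] by (auto simp: r_def divide_simps add_nonneg_pos intro: le_less_trans[OF abs_ge_self])
    have "(\<lambda>n. c * r * Re (fval t (u n) (u n))) \<longlonglongrightarrow> c * r * Re 0"
      by (intro tendsto_intros lim)
    then have "\<forall>\<^sub>F n in sequentially. c * r * Re (fval t (u n) (u n)) < e - ?k / r"
      using r(2) by (intro order_tendstoD(2)) auto
    then show "\<forall>\<^sub>F n in sequentially. dist (fval t (u n) y) 0 < e"
    proof eventually_elim
      case (elim n)
      then show ?case using c(2)[OF u[of n] y r(1)] by (simp add: algebra_simps)
    qed
  qed
qed


section \<open>Forms of closed operators\<close>

text \<open>T is a closed operator, possibly without dense domain, and induces the form (C T \<phi>,
  T \<psi>). The instances are the operator part of K^* and closed restrictions of it.\<close>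

locale operator_form = bounded_symmetric B
  for B :: "'b::complex_hilbert \<Rightarrow> 'b" +
  fixes T :: "('a::complex_hilbert \<times> 'b) set"
  assumes csubspace_T: "csubspace T"
    and closed_T: "closed T"
    and single_valued_T: "single_valued T"
begin

definition T_val :: "'a \<Rightarrow> 'b" where "T_val x = (THE y. (x, y) \<in> T)"

definition T_form :: "'a form"
  where "T_form = Form (Domain T) (\<lambda>\<phi> \<psi>. cinner (C (T_val \<phi>)) (T_val \<psi>))"

abbreviation H :: "('a \<times> 'a) set" where "H \<equiv> rel_of_form T_form"

lemma T_val_eq: "(x, y) \<in> T \<Longrightarrow> T_val x = y"
  unfolding T_val_def using single_valuedD[OF single_valued_T] by blast

lemma T_val_mem: "x \<in> Domain T \<Longrightarrow> (x, T_val x) \<in> T"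
  using T_val_eq by blast

lemma fdom_T_form [simp]: "fdom T_form = Domain T"
  by (simp add: T_form_def)

lemma fval_T_form: "(\<phi>, g) \<in> T \<Longrightarrow> (\<psi>, p) \<in> T \<Longrightarrow> fval T_form \<phi> \<psi> = cinner (C g) p"
  by (simp add: T_form_def T_val_eq)

lemma T_zero: "(0, 0) \<in> T"
  and T_add: "(f, f') \<in> T \<Longrightarrow> (g, g') \<in> T \<Longrightarrow> (f + g, f' + g') \<in> T"
  and T_scale: "(f, f') \<in> T \<Longrightarrow> (a *\<^sub>C f, a *\<^sub>C f') \<in> T"
  using csubspace_T by (auto simp: csubspace_rel_iff)

lemma T_diff: "(f, f') \<in> T \<Longrightarrow> (g, g') \<in> T \<Longrightarrow> (f - g, f' - g') \<in> T"
  using complex_vector.subspace_diff[OF csubspace_T, of "(f, f')" "(g, g')"] by simp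

lemma sectorial_T_form: "sectorial_form T_form"
proof -
  have "sesquilinear_form T_form"
    unfolding sesquilinear_form_def fdom_T_form
  proof (intro conjI ballI allI csubspace_Domain csubspace_T)
    fix \<phi> \<psi> \<omega> a assume "\<phi> \<in> Domain T" "\<psi> \<in> Domain T" "\<omega> \<in> Domain T"
    then obtain f g h where *: "(\<phi>, f) \<in> T" "(\<psi>, g) \<in> T" "(\<omega>, h) \<in> T" by blast
    note val = fval_T_form[OF *(1) *(3)] fval_T_form[OF *(2) *(3)]
      fval_T_form[OF *(3) *(1)] fval_T_form[OF *(3) *(2)]
      fval_T_form[OF T_add[OF *(1) *(2)] *(3)] fval_T_form[OF *(3) T_add[OF *(1) *(2)]]
      fval_T_form[OF T_scale[OF *(1)] *(3)] fval_T_form[OF *(3) T_scale[OF *(1)]]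
    show "fval T_form (\<phi> + \<psi>) \<omega> = fval T_form \<phi> \<omega> + fval T_form \<psi> \<omega>"
      "fval T_form \<omega> (\<phi> + \<psi>) = fval T_form \<omega> \<phi> + fval T_form \<omega> \<psi>"
      "fval T_form (a *\<^sub>C \<phi>) \<omega> = a * fval T_form \<phi> \<omega>"
      "fval T_form \<omega> (a *\<^sub>C \<phi>) = cnj a * fval T_form \<omega> \<phi>"
      by (simp_all add: val C_add C_scaleC cinner_linear)
  qed
  moreover obtain \<alpha> where "0 \<le> \<alpha>" "\<alpha> < pi / 2" "\<And>x. in_sector \<alpha> (cinner (C x) x)"
    using C_sectorial by blast
  ultimately show ?thesis
    by (auto simp: sectorial_form_def fval_T_form intro!: exI[of _ \<alpha>])
qed

text \<open>Convergence with respect to the form makes the images T u_n a Cauchy sequence, by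
  \<open>Cauchy_iff_C\<close>; closedness of T then places the pair of limits in T.\<close>

lemma form_conv_T_form:
  assumes "form_conv T_form u \<phi>"
  shows "\<exists>g. (\<phi>, g) \<in> T \<and> (\<lambda>n. T_val (u n)) \<longlonglongrightarrow> g"
proof -
  have u: "\<And>n. u n \<in> Domain T" "u \<longlonglongrightarrow> \<phi>"
    "\<And>e. e > 0 \<Longrightarrow> \<exists>N. \<forall>m\<ge>N. \<forall>n\<ge>N. cmod (fval T_form (u n - u m) (u n - u m)) < e"
    using assms by (auto simp: form_conv_def)
  define g where "g n = T_val (u n)" for n
  have g: "(u n, g n) \<in> T" for n using u(1) T_val_mem by (simp add: g_def)
  have "Cauchy g"
    unfolding Cauchy_iff_C using u(3) by (simp add: fval_T_form[OF T_diff[OF g g] T_diff[OF g g]])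
  then obtain l where l: "g \<longlonglongrightarrow> l" using Cauchy_convergent convergent_def by blast
  then have "(\<lambda>n. (u n, g n)) \<longlonglongrightarrow> (\<phi>, l)" by (intro tendsto_Pair u)
  then have "(\<phi>, l) \<in> T" using closed_sequentially[OF closed_T, of "\<lambda>n. (u n, g n)" "(\<phi>, l)"] g by blast
  then show ?thesis using l unfolding g_def by blast
qed

lemma closed_T_form: "closed_form T_form"
  unfolding closed_form_def
proof (intro allI impI)
  fix u \<phi> assume conv: "form_conv T_form u \<phi>"
  then obtain g where g: "(\<phi>, g) \<in> T" "(\<lambda>n. T_val (u n)) \<longlonglongrightarrow> g"
    using form_conv_T_form by blast
  have "(u n - \<phi>, T_val (u n) - g) \<in> T" for n
    using conv g(1) by (intro T_diff T_val_mem) (auto simp: form_conv_def)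
  then have "(\<lambda>n. fval T_form (u n - \<phi>) (u n - \<phi>))
    = (\<lambda>n. cinner (C (T_val (u n) - g)) (T_val (u n) - g))"
    using fval_T_form by blast
  moreover have "\<dots> \<longlonglongrightarrow> cinner (C (g - g)) (g - g)"
    by (intro tendsto_intros g(2))
  ultimately show "\<phi> \<in> fdom T_form \<and> (\<lambda>n. fval T_form (u n - \<phi>) (u n - \<phi>)) \<longlonglongrightarrow> 0"
    using g(1) by auto
qed

lemma corresponding_T_form: "corresponding_form H T_form"
  by (simp add: corresponding_form_def sectorial_T_form closed_T_form)

lemma H_iff:
  "(\<phi>, \<phi>') \<in> H \<longleftrightarrow> (\<exists>g. (\<phi>, g) \<in> T \<and> (\<forall>\<psi> p. (\<psi>, p) \<in> T \<longrightarrow> cinner (C g) p = cinner \<phi>' \<psi>))"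
  (is "?l \<longleftrightarrow> ?r")
proof
  assume ?l
  then obtain g where g: "(\<phi>, g) \<in> T" "\<And>\<psi>. \<psi> \<in> Domain T \<Longrightarrow> fval T_form \<phi> \<psi> = cinner \<phi>' \<psi>"
    by (auto simp: rel_of_form_def)
  have "cinner (C g) p = cinner \<phi>' \<psi>" if "(\<psi>, p) \<in> T" for \<psi> p
    using g(2)[of \<psi>] that fval_T_form[OF g(1) that] by (metis DomainI)
  then show ?r using g(1) by blast
next
  assume ?r
  then show ?l by (auto simp: rel_of_form_def fval_T_form)
qed

lemma H_eq_product: "H = adjoint_rel T \<odot> graph_of C \<odot> T"
proof -
  have "(\<phi>, \<phi>') \<in> H \<longleftrightarrow> (\<phi>, \<phi>') \<in> adjoint_rel T \<odot> graph_of C \<odot> T" for \<phi> \<phi>'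
    unfolding H_iff by (auto simp: relcomp_unfold graph_of_def adjoint_rel_iff)
  then show ?thesis by auto
qed

section \<open>Maximality of the relation of the form\<close>

lemma csubspace_H: "csubspace H"
proof -
  have "(0, 0) \<in> H"
    unfolding H_iff by (rule exI[of _ 0]) (simp add: T_zero)
  moreover have "(f + g, f' + g') \<in> H" if "(f, f') \<in> H" "(g, g') \<in> H" for f f' g g'
  proof -
    from that obtain p q where "(f, p) \<in> T" "\<forall>\<psi> r. (\<psi>, r) \<in> T \<longrightarrow> cinner (C p) r = cinner f' \<psi>"
      "(g, q) \<in> T" "\<forall>\<psi> r. (\<psi>, r) \<in> T \<longrightarrow> cinner (C q) r = cinner g' \<psi>"
      unfolding H_iff by blast
    then show ?thesis
      unfolding H_iff by (intro exI[of _ "p + q"]) (simp add: T_add C_add cinner_linear)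
  qed
  moreover have "(a *\<^sub>C f, a *\<^sub>C f') \<in> H" if "(f, f') \<in> H" for a f f'
  proof -
    from that obtain p where "(f, p) \<in> T" "\<forall>\<psi> r. (\<psi>, r) \<in> T \<longrightarrow> cinner (C p) r = cinner f' \<psi>"
      unfolding H_iff by blast
    then show ?thesis
      unfolding H_iff by (intro exI[of _ "a *\<^sub>C p"]) (simp add: T_scale C_scaleC cinner_linear)
  qed
  ultimately show ?thesis by (auto simp: csubspace_rel_iff)
qed

lemma sectorial_H: "sectorial H"
proof -
  obtain \<alpha> where \<alpha>: "0 \<le> \<alpha>" "\<alpha> < pi / 2" "\<And>x. in_sector \<alpha> (cinner (C x) x)"
    using C_sectorial by blast
  have "in_sector \<alpha> (cinner h' h)" if "(h, h') \<in> H" for h h'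
    using that \<alpha>(3) unfolding H_iff by metis
  then show ?thesis
    using \<alpha>(1,2) csubspace_H by (auto simp: sectorial_def linear_relation_def)
qed

text \<open>Lax-Milgram on the graph of T for I \<oplus> C with right-hand side {w, 0}.
  Orthogonality of the residual {w - \<phi>, - C g} to the graph is exactly the condition {\<phi>, w
  - \<phi>} \<in> H.\<close>

lemma H_plus_id_surj: "\<exists>\<phi> \<phi>'. (\<phi>, \<phi>') \<in> H \<and> \<phi> + \<phi>' = w"
proof -
  interpret P: bounded_symmetric "map_prod (\<lambda>_::'a. 0) B" by (rule bounded_symmetric_prod)
  obtain \<phi> g where g: "(\<phi>, g) \<in> T" "(w, 0) - P.C (\<phi>, g) \<in> ortho_compl T"
    using P.lax_milgram[OF csubspace_T closed_T, of "(w, 0)"] by auto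
  have "cinner (w - \<phi>) \<psi> - cinner (C g) p = 0" if "(\<psi>, p) \<in> T" for \<psi> p
    using g(2) that by (auto simp: ortho_compl_def one_plus_i_prod cinner_prod_def)
  then have "(\<phi>, w - \<phi>) \<in> H" unfolding H_iff using g(1) by force
  then show ?thesis by force
qed

text \<open>Given {f, f'} in a sectorial extension, some {g, g'} \<in> H has the same sum of
  entries. The difference is {f - g, -(f - g)}, and the sector condition forces -|f - g|^2 \<ge>
  0.\<close>

lemma maximal_sectorial_H: "maximal_sectorial H"
  unfolding maximal_sectorial_def
proof (intro conjI allI impI sectorial_H, elim conjE)
  fix S assume S: "sectorial S" "H \<subseteq> S"
  have "(f, f') \<in> H" if f: "(f, f') \<in> S" for f f'
  proof -
    obtain g g' where g: "(g, g') \<in> H" "g + g' = f + f'" using H_plus_id_surj by blast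
    have "(f, f') - (g, g') \<in> S"
      using S f g(1) by (intro complex_vector.subspace_diff) (auto simp: sectorial_def linear_relation_def)
    moreover have "f' - g' = - (f - g)" using g(2) by (simp add: algebra_simps)
    ultimately have "0 \<le> Re (cinner (- (f - g)) (f - g))"
      using S(1) by (fastforce simp: sectorial_def in_sector_def)
    then have "0 \<le> - (norm (f - g))\<^sup>2"
      by (simp only: cinner_minus_left cinner_self uminus_complex.sel Re_complex_of_real)
    then have "f = g" by simp
    then show ?thesis using g by simp
  qed
  then show "S = H" using S(2) by auto
qed

section \<open>The closed form is determined by its relation\<close>

lemma cinner_C_T_H:
  assumes "(\<psi>, \<psi>') \<in> H" "(\<psi>, p) \<in> T" "(u, q) \<in> T"
  shows "cinner (C p) q = cinner \<psi>' u"
  using assms single_valuedD[OF single_valued_T] unfolding H_iff by metis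

text \<open>dom H is a core of T. The skew projection {u, q} of {\<phi>, g} onto the closure leaves
  an error whose first entry \<phi> - u is orthogonal to the range of H + I, hence zero.\<close>

lemma Domain_H_core: "closure (T \<inter> Domain H \<times> UNIV) = T"
proof (rule antisym)
  let ?V = "closure (T \<inter> Domain H \<times> UNIV)"
  show VT: "?V \<subseteq> T" using closed_T by (intro closure_minimal) auto
  have "csubspace (T \<inter> Domain H \<times> UNIV)"
    using csubspace_T csubspace_Domain[OF csubspace_H]
    by (auto simp: csubspace_rel_iff complex_vector.subspace_def[of "Domain _"])
  then have V: "csubspace ?V" "closed ?V" by (auto intro: csubspace_closure)
  interpret P: bounded_symmetric "map_prod (\<lambda>_::'a. 0) B" by (rule bounded_symmetric_prod)
  show "T \<subseteq> ?V"
  proof clarify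
    fix \<phi> g assume g: "(\<phi>, g) \<in> T"
    obtain u q where u: "(u, q) \<in> ?V" "\<And>x. x \<in> ?V \<Longrightarrow> cinner (P.C x) (u, q) = cinner (P.C x) (\<phi>, g)"
      using P.lax_milgram_projection[OF V, of "(\<phi>, g)"] by auto
    have uT: "(u, q) \<in> T" using u(1) VT by blast
    obtain \<psi> \<psi>' where \<psi>: "(\<psi>, \<psi>') \<in> H" "\<psi> + \<psi>' = \<phi> - u" using H_plus_id_surj by blast
    obtain p where p: "(\<psi>, p) \<in> T" using \<psi>(1) unfolding H_iff by blast
    have "(\<psi>, p) \<in> ?V" using \<psi>(1) p subsetD[OF closure_subset, of "(\<psi>, p)" "T \<inter> Domain H \<times> UNIV"] by auto
    from u(2)[OF this] have "cinner (\<psi> + \<psi>') (\<phi> - u) = 0"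
      using cinner_C_T_H[OF \<psi>(1) p uT] cinner_C_T_H[OF \<psi>(1) p g]
      by (simp add: one_plus_i_prod cinner_prod_def cinner_linear)
    then have "\<phi> = u" by (simp add: \<psi>(2))
    then show "(\<phi>, g) \<in> ?V" using g uT u(1) single_valuedD[OF single_valued_T] by metis
  qed
qed

text \<open>On dom H the relation already dictates the values of s. As dom H is a core of T, each
  element of dom T is an s-limit of elements of dom H, so closedness of s carries membership and
  values over to dom T.\<close>

lemma corresponding_form_extends:
  assumes s: "corresponding_form H s" and g: "(\<phi>, g) \<in> T"
  shows "\<phi> \<in> fdom s"
    and "\<And>\<psi> p. \<psi> \<in> fdom s \<Longrightarrow> (\<psi>, p) \<in> T \<Longrightarrow> fval s \<phi> \<psi> = cinner (C g) p"
proof -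
  have sec: "sectorial_form s" and sq: "sesquilinear_form s" and cl: "closed_form s" and Hs: "H = rel_of_form s"
    using s by (auto simp: corresponding_form_def sectorial_form_def)
  have dom: "Domain H \<subseteq> fdom s" unfolding Hs by (auto simp: rel_of_form_def)
  have val: "fval s x y = cinner (C p) q" if x: "x \<in> Domain H" "(x, p) \<in> T" "y \<in> fdom s" "(y, q) \<in> T" for x y p q
  proof -
    obtain x' where x': "(x, x') \<in> H" using x(1) by blast
    then have "(x, x') \<in> rel_of_form s" using Hs by simp
    then have "fval s x y = cinner x' y" using x(3) by (auto simp: rel_of_form_def)
    then show ?thesis using cinner_C_T_H[OF x' x(2,4)] by simp
  qed
  obtain v where v: "\<And>n. v n \<in> T \<inter> Domain H \<times> UNIV" "v \<longlonglongrightarrow> (\<phi>, g)"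
    using g closure_sequential[of "(\<phi>, g)" "T \<inter> Domain H \<times> UNIV"] Domain_H_core by auto
  define u where "u n = fst (v n)" for n
  define h where "h n = snd (v n)" for n
  have u: "u n \<in> Domain H" "(u n, h n) \<in> T" for n
    using v(1)[of n] by (auto simp: u_def h_def mem_Times_iff)
  have lim: "u \<longlonglongrightarrow> \<phi>" "h \<longlonglongrightarrow> g"
    using tendsto_fst[OF v(2)] tendsto_snd[OF v(2)] by (simp_all add: u_def[abs_def] h_def[abs_def])
  have conv: "form_conv s u \<phi>"
    unfolding form_conv_def
  proof (intro conjI allI impI lim)
    show "u n \<in> fdom s" for n using u(1) dom by blast
    fix e :: real assume e: "e > 0"
    have "fval s (u j - u i) (u j - u i) = cinner (C (h j - h i)) (h j - h i)" for i j
    proof -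
      have d: "(u j - u i, h j - h i) \<in> T" "u j - u i \<in> Domain H"
        using T_diff u complex_vector.subspace_diff[OF csubspace_Domain[OF csubspace_H]] by auto
      then show ?thesis using val[OF d(2,1) subsetD[OF dom d(2)] d(1)] by simp
    qed
    then show "\<exists>N. \<forall>i\<ge>N. \<forall>j\<ge>N. cmod (fval s (u j - u i) (u j - u i)) < e"
      using LIMSEQ_imp_Cauchy[OF lim(2)] e by (simp add: Cauchy_iff_C)
  qed
  then show \<phi>: "\<phi> \<in> fdom s" using cl by (auto simp: closed_form_def)
  fix \<psi> p assume \<psi>: "\<psi> \<in> fdom s" "(\<psi>, p) \<in> T"
  have ud: "u n \<in> fdom s" for n using u(1) dom by blast
  have "(\<lambda>n. fval s (u n - \<phi>) (u n - \<phi>)) \<longlonglongrightarrow> 0"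
    using conv cl by (auto simp: closed_form_def)
  then have "(\<lambda>n. fval s (u n - \<phi>) \<psi>) \<longlonglongrightarrow> 0"
    using \<psi>(1) ud \<phi> complex_vector.subspace_diff[OF csubspace_fdom[OF sq]]
    by (intro sectorial_form_tendsto_0[OF sec]) auto
  moreover have "fval s (u n - \<phi>) \<psi> = cinner (C (h n)) p - fval s \<phi> \<psi>" for n
    using sesquilinear_formD(5)[OF sq ud \<phi> \<psi>(1)] val[OF u \<psi>] by simp
  ultimately have "(\<lambda>n. cinner (C (h n)) p - fval s \<phi> \<psi>) \<longlonglongrightarrow> 0" by simp
  moreover have "(\<lambda>n. cinner (C (h n)) p - fval s \<phi> \<psi>) \<longlonglongrightarrow> cinner (C g) p - fval s \<phi> \<psi>"
    by (intro tendsto_intros lim)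
  ultimately have "cinner (C g) p - fval s \<phi> \<psi> = 0" by (metis LIMSEQ_unique)
  then show "fval s \<phi> \<psi> = cinner (C g) p" by simp
qed

text \<open>The form is determined by its relation: for \<open>u\<close> in the domain of the other form, Riesz and
  Lax--Milgram on the graph of \<open>T\<close> yield \<open>v\<close> in the domain of \<open>T\<close> such that \<open>u - v\<close> is orthogonal
  to the range of \<open>H + I\<close>.\<close>

lemma corresponding_form_unique:
  assumes s: "corresponding_form H s"
  shows "form_restriction s T_form"
proof -
  have sec: "sectorial_form s" and sq: "sesquilinear_form s" and Hs: "H = rel_of_form s"
    using s by (auto simp: corresponding_form_def sectorial_form_def)
  note ext = corresponding_form_extends[OF s]
  obtain c where c: "c \<ge> 0" "\<And>x y r. x \<in> fdom s \<Longrightarrow> y \<in> fdom s \<Longrightarrow> r > 0 \<Longrightarrow>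
    cmod (fval s x y) \<le> c * (r * Re (fval s x x) + Re (fval s y y) / r)"
    using sectorial_form_bound[OF sec] by blast
  interpret P: bounded_symmetric "map_prod (\<lambda>_::'a. 0) B" by (rule bounded_symmetric_prod)
  have "u \<in> Domain T" if u: "u \<in> fdom s" for u
  proof -
    \<comment> \<open>Pairing with u through s + I. It makes sense on T because \<open>ext\<close>
      puts the first entries of T into the domain of s.\<close>
    define f where "f x = fval s (fst x) u + cinner (fst x) u" for x :: "'a \<times> 'b"
    have dom: "fst x \<in> fdom s" if "x \<in> T" for x
      using ext(1)[of "fst x" "snd x"] that by simp
    have "\<exists>z\<in>T. \<forall>x\<in>T. f x = cinner x z"
    proof (rule riesz_on_subspace[OF csubspace_T closed_T])
      show "f (x + y) = f x + f y" if "x \<in> T" "y \<in> T" for x y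
        using sesquilinear_formD(1)[OF sq dom dom u] that by (simp add: f_def cinner_linear)
      show "f (a *\<^sub>C x) = a * f x" if "x \<in> T" for a x
        using sesquilinear_formD(3)[OF sq dom u u] that
        by (simp add: f_def cinner_linear scaleC_prod_def algebra_simps)
      show "cmod (f x) \<le> (c * (1 + Re (fval s u u)) + norm u) * norm x" if x: "x \<in> T" for x
      proof (cases "x = 0")
        case True
        then show ?thesis using sesquilinear_form_zero[OF sq u] by (simp add: f_def)
      next
        case False
        obtain \<psi> g where xg: "x = (\<psi>, g)" by fastforce
        let ?N = "norm x"
        have N: "?N > 0" using False by simp
        have g: "(\<psi>, g) \<in> T" using x xg by simp
        have le: "norm \<psi> \<le> ?N" "norm g \<le> ?N"
          unfolding xg by (simp_all add: norm_prod_def)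
        have "Re (fval s \<psi> \<psi>) = (norm g)\<^sup>2"
          using ext(2)[OF g ext(1)[OF g] g] by (simp add: Re_cinner_C)
        also have "\<dots> \<le> ?N\<^sup>2" using le by (intro power_mono) auto
        finally have "1 / ?N * Re (fval s \<psi> \<psi>) \<le> ?N"
          using N by (simp add: divide_simps power2_eq_square)
        then have q: "1 / ?N * Re (fval s \<psi> \<psi>) + Re (fval s u u) / (1 / ?N)
            \<le> ?N + Re (fval s u u) / (1 / ?N)"
          by simp
        \<comment> \<open>The weight r = 1/|x| turns both terms into multiples of |x|, which yields
          the linear bound required by Riesz.\<close>
        have "cmod (fval s \<psi> u) \<le> c * (1 / ?N * Re (fval s \<psi> \<psi>) + Re (fval s u u) / (1 / ?N))"
          using N by (intro c(2) ext(1)[OF g] u) simp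
        also have "\<dots> \<le> c * (?N + Re (fval s u u) / (1 / ?N))"
          by (rule mult_left_mono[OF q c(1)])
        finally have "cmod (fval s \<psi> u) \<le> c * (?N + Re (fval s u u) / (1 / ?N))" .
        moreover have "cmod (cinner \<psi> u) \<le> ?N * norm u"
          using cmod_cinner_le[of \<psi> u] le(1) by (meson mult_right_mono norm_ge_zero order_trans)
        ultimately have "cmod (fval s \<psi> u) + cmod (cinner \<psi> u) \<le> c * (?N + Re (fval s u u) * ?N) + ?N * norm u"
          by simp
        then show ?thesis
          using norm_triangle_ineq[of "fval s \<psi> u" "cinner \<psi> u"] by (simp add: f_def xg algebra_simps)
      qed
    qed
    then obtain z where z: "\<And>x. x \<in> T \<Longrightarrow> f x = cinner x z" by blast
    obtain v q where v: "(v, q) \<in> T" "\<And>x. x \<in> T \<Longrightarrow> cinner (P.C x) (v, q) = cinner x z"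
      using P.lax_milgram_adjoint[OF csubspace_T closed_T, of z] by auto
    obtain \<psi> \<psi>' where \<psi>: "(\<psi>, \<psi>') \<in> H" "\<psi> + \<psi>' = u - v" using H_plus_id_surj by blast
    obtain p where p: "(\<psi>, p) \<in> T" using \<psi>(1) unfolding H_iff by blast
    have "(\<psi>, \<psi>') \<in> rel_of_form s" using \<psi>(1) Hs by simp
    then have "fval s \<psi> u = cinner \<psi>' u" using u by (auto simp: rel_of_form_def)
    \<comment> \<open>At {\<psi>, p} the functional f equals (\<psi>' + \<psi>, u), with H read as
      the relation of s, and (\<psi> + \<psi>', v), with H read as the relation of the form of
      T.\<close>
    then have "cinner (\<psi> + \<psi>') u = cinner (\<psi> + \<psi>') v"
      using z[OF p] v(2)[OF p] cinner_C_T_H[OF \<psi>(1) p v(1)]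
      by (simp add: f_def one_plus_i_prod cinner_prod_def cinner_linear add.commute)
    then have "cinner (u - v) (u - v) = 0" by (simp add: \<psi>(2) cinner_diff_right)
    then show ?thesis using v(1) by auto
  qed
  then have sub: "fdom s \<subseteq> Domain T" by blast
  moreover have "fval s \<phi> \<psi> = fval T_form \<phi> \<psi>" if "\<phi> \<in> fdom s" "\<psi> \<in> fdom s" for \<phi> \<psi>
    using that sub ext(2)[OF T_val_mem _ T_val_mem, of \<phi> \<psi>]
    by (auto simp: T_form_def)
  ultimately show ?thesis by (auto simp: form_restriction_def)
qed

end


section \<open>Extremal extensions of a factorized sectorial relation\<close>

text \<open>Here \<open>J\<close> plays the role of \<open>f \<mapsto> {A\<^sub>1\<^sub>s\<^sup>1\<^sup>/\<^sup>2 f, A\<^sub>2\<^sub>s\<^sup>1\<^sup>/\<^sup>2 f}\<close>, and \<open>S\<close> that of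
  \<open>H\<^sub>1 + H\<^sub>2\<close>.\<close>

locale factorized_relation = bounded_symmetric B
  for B :: "'b::complex_hilbert \<Rightarrow> 'b" +
  fixes S :: "('a::complex_hilbert \<times> 'a) set" and J :: "'a \<Rightarrow> 'b"
  assumes csubspace_S: "csubspace S"
    and J_add: "x \<in> Domain S \<Longrightarrow> y \<in> Domain S \<Longrightarrow> J (x + y) = J x + J y"
    and J_scaleC: "x \<in> Domain S \<Longrightarrow> J (a *\<^sub>C x) = a *\<^sub>C J x"
    and cinner_S: "(x, x') \<in> S \<Longrightarrow> y \<in> Domain S \<Longrightarrow> cinner x' y = cinner (C (J x)) (J y)"
    and closure_eq: "closure (J ` Domain S) = closure (C ` J ` Domain S)"
begin

definition K :: "('b \<times> 'a) set" where "K = (\<lambda>(x, x'). (C (J x), x')) ` S"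

text \<open>\<open>K\<close> without the factor \<open>C\<close>. Read backwards it sends x' to J x,
  the vector in terms of which the form of the inverse of S is expressed.\<close>

definition N :: "('b \<times> 'a) set" where "N = (\<lambda>(x, x'). (J x, x')) ` S"

abbreviation \<DD> :: "'b set" where "\<DD> \<equiv> closure (J ` Domain S)"

abbreviation TK :: "('a \<times> 'b) set" where "TK \<equiv> operator_part (adjoint_rel K)"

lemma S_add: "(x, x') \<in> S \<Longrightarrow> (y, y') \<in> S \<Longrightarrow> (x + y, x' + y') \<in> S"
  and S_scaleC: "(x, x') \<in> S \<Longrightarrow> (a *\<^sub>C x, a *\<^sub>C x') \<in> S"
  and S_zero: "(0, 0) \<in> S"
  using csubspace_S by (auto simp: csubspace_rel_iff)

lemma S_diff: "(x, x') \<in> S \<Longrightarrow> (y, y') \<in> S \<Longrightarrow> (x - y, x' - y') \<in> S"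
  using complex_vector.subspace_diff[OF csubspace_S, of "(x, x')" "(y, y')"] by simp

lemma J_zero: "J 0 = 0"
  using J_scaleC[of 0 0] S_zero by auto

lemma J_diff: "x \<in> Domain S \<Longrightarrow> y \<in> Domain S \<Longrightarrow> J (x - y) = J x - J y"
  using J_add[of "x - y" y] complex_vector.subspace_diff[OF csubspace_Domain[OF csubspace_S], of x y]
  by simp

lemma csubspace_N: "csubspace N"
proof -
  have "(0, 0) \<in> N" unfolding N_def using S_zero J_zero by force
  moreover have "(f + g, f' + g') \<in> N" if "(f, f') \<in> N" "(g, g') \<in> N" for f f' g g'
  proof -
    from that obtain x y where "(x, f') \<in> S" "f = J x" "(y, g') \<in> S" "g = J y"
      by (auto simp: N_def)
    then show ?thesis unfolding N_def
      using S_add[of x f' y g'] J_add[of x y] by (force intro!: image_eqI[of _ _ "(x + y, f' + g')"])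
  qed
  moreover have "(a *\<^sub>C f, a *\<^sub>C f') \<in> N" if "(f, f') \<in> N" for a f f'
  proof -
    from that obtain x where "(x, f') \<in> S" "f = J x" by (auto simp: N_def)
    then show ?thesis unfolding N_def
      using S_scaleC[of x f' a] J_scaleC[of x a] by (force intro!: image_eqI[of _ _ "(a *\<^sub>C x, a *\<^sub>C f')"])
  qed
  ultimately show ?thesis by (auto simp: csubspace_rel_iff)
qed

lemma N_iff: "(g, x') \<in> N \<longleftrightarrow> (\<exists>x. (x, x') \<in> S \<and> g = J x)"
  by (force simp: N_def)

lemma K_iff_N: "(h, x') \<in> K \<longleftrightarrow> (\<exists>g. (g, x') \<in> N \<and> h = C g)"
  by (force simp: K_def N_def)

lemma csubspace_K: "csubspace K"
proof -
  have N: "(0, 0) \<in> N" "\<And>f f' g g'. (f, f') \<in> N \<Longrightarrow> (g, g') \<in> N \<Longrightarrow> (f + g, f' + g') \<in> N"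
    "\<And>a f f'. (f, f') \<in> N \<Longrightarrow> (a *\<^sub>C f, a *\<^sub>C f') \<in> N"
    using csubspace_N by (auto simp: csubspace_rel_iff)
  have "(0, 0) \<in> K" unfolding K_iff_N using N(1) C_zero by force
  moreover have "(f + g, f' + g') \<in> K" if "(f, f') \<in> K" "(g, g') \<in> K" for f f' g g'
  proof -
    from that obtain p q where "(p, f') \<in> N" "f = C p" "(q, g') \<in> N" "g = C q"
      unfolding K_iff_N by blast
    then show ?thesis
      unfolding K_iff_N using N(2)[of p f' q g'] by (intro exI[of _ "p + q"]) (simp add: C_add)
  qed
  moreover have "(a *\<^sub>C f, a *\<^sub>C f') \<in> K" if "(f, f') \<in> K" for a f f'
  proof -
    from that obtain p where "(p, f') \<in> N" "f = C p"
      unfolding K_iff_N by blast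
    then show ?thesis
      unfolding K_iff_N using N(3)[of p f' a] by (intro exI[of _ "a *\<^sub>C p"]) (simp add: C_scaleC)
  qed
  ultimately show ?thesis by (auto simp: csubspace_rel_iff)
qed

lemma Domain_N: "Domain N = J ` Domain S"
  and Domain_K: "Domain K = C ` J ` Domain S"
  by (force simp: N_def K_def Domain_iff)+

lemma csubspace_D: "csubspace \<DD>"
  unfolding Domain_N[symmetric] by (intro csubspace_closure csubspace_Domain csubspace_N)

text \<open>By \<open>closure_eq\<close>, \<DD> is also the closure of dom K, and so the complement
  of mul K^*.\<close>

lemma TK_iff: "(f, g) \<in> TK \<longleftrightarrow> (f, g) \<in> adjoint_rel K \<and> g \<in> \<DD>"
  by (simp add: operator_part_adjoint_rel csubspace_K Domain_K closure_eq)

lemma adjoint_K_iff: "(f, g) \<in> adjoint_rel K \<longleftrightarrow> (\<forall>x x'. (x, x') \<in> S \<longrightarrow> cinner f x' = cinner g (C (J x)))"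
  by (fastforce simp: adjoint_rel_iff K_def)

text \<open>By continuity C maps \<DD> into the closure of C J dom S, which is \<DD> again by
  \<open>closure_eq\<close>.\<close>

lemma C_D:
  assumes "g \<in> \<DD>"
  shows "C g \<in> \<DD>"
proof -
  have "C ` \<DD> \<subseteq> closure (C ` J ` Domain S)"
    by (rule image_closure_subset)
      (auto intro: bounded_linear.continuous_on[OF bounded_linear_C continuous_on_id]
        subsetD[OF closure_subset])
  then show ?thesis using assms unfolding closure_eq[symmetric] by blast
qed

text \<open>The operator part of K^* extends J, by the conjugate of \<open>cinner_S\<close>. Hence
  its restriction to any L containing dom S still contains J.\<close>

lemma J_TK: "x \<in> Domain S \<Longrightarrow> (x, J x) \<in> TK"
  unfolding TK_iff adjoint_K_iff
  using cinner_S cinner_commute closure_subset[of "J ` Domain S"] by (metis image_eqI subsetD)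

sublocale K: operator_form B TK
  by unfold_locales
    (simp_all add: csubspace_operator_part closed_operator_part single_valued_operator_part
      csubspace_adjoint_rel closed_adjoint_rel)

text \<open>The form of the inverse of \<open>S\<close> is \<open>(Jx, CJy)\<close>, so that its closure is computed on the closure
  of \<open>N\<close>.\<close>

lemma cinner_inverse_S:
  assumes "(x, x') \<in> S" "(y, y') \<in> S"
  shows "cinner x y' = cinner (J x) (C (J y))"
  using cinner_S[OF assms(2), of x] assms(1) cinner_commute by (metis DomainI)

text \<open>Well-definedness of the form of the inverse: two choices of x for the same x' differ by
  an element z of ker S, and |J z|^2 = Re (0, z) = 0.\<close>

lemma J_unique:
  assumes "(x, z) \<in> S" "(y, z) \<in> S"
  shows "J x = J y"
proof -
  have "(x - y, 0) \<in> S" using S_diff[OF assms] by simp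
  then have "cinner (C (J (x - y))) (J (x - y)) = 0" using cinner_S[of "x - y" 0 "x - y"] by auto
  then have "J (x - y) = 0" using Re_cinner_C[of "J (x - y)"] by simp
  then show ?thesis using J_diff[of x y] assms by auto
qed

abbreviation inverse_form :: "'a form" where "inverse_form \<equiv> form_of_rel (converse S)"

lemma fval_inverse_form:
  assumes "(x, x') \<in> S" "(y, y') \<in> S"
  shows "fval inverse_form x' y' = cinner (J x) (C (J y))"
proof -
  have "(THE c. \<exists>\<phi>. (x', \<phi>) \<in> converse S \<and> c = cinner \<phi> y') = cinner (J x) (C (J y))"
  proof (rule the_equality)
    show "\<exists>\<phi>. (x', \<phi>) \<in> converse S \<and> cinner (J x) (C (J y)) = cinner \<phi> y'"
      using assms cinner_inverse_S by force
  next
    fix c assume "\<exists>\<phi>. (x', \<phi>) \<in> converse S \<and> c = cinner \<phi> y'"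
    then show "c = cinner (J x) (C (J y))"
      using cinner_inverse_S[OF _ assms(2)] J_unique[OF assms(1)] by auto
  qed
  then show ?thesis by (simp add: form_of_rel_def)
qed

lemma cmod_fval_inverse_form:
  assumes "(x, x') \<in> S"
  shows "cmod (fval inverse_form x' x') = cmod (cinner (C (J x)) (J x))"
  unfolding fval_inverse_form[OF assms assms] by (metis cinner_commute complex_mod_cnj)

section \<open>Closure of the form of the inverse\<close>

lemma closure_N_D:
  assumes "(g, x) \<in> closure N"
  shows "g \<in> \<DD>"
proof -
  have "closure N \<subseteq> \<DD> \<times> UNIV"
    by (rule closure_minimal) (auto simp: N_def closed_Times intro: subsetD[OF closure_subset])
  then show ?thesis using assms by auto
qed

text \<open>Closability of the form of the inverse. The identity (x, y') = (J x, C J y) survives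
  limits in the second pair, giving (J x, C g) = 0. So C g is orthogonal to \<DD>, which contains g,
  and Re (C g, g) = |g|^2 vanishes.\<close>

lemma N_closable:
  assumes "(g, 0) \<in> closure N"
  shows "g = 0"
proof -
  have N_sub: "N \<subseteq> {p. \<forall>x x'. (x, x') \<in> S \<longrightarrow> cinner x (snd p) = cinner (J x) (C (fst p))}"
    using cinner_inverse_S by (auto simp: N_def)
  have N_closed: "closed {p::'b \<times> 'a. \<forall>x x'. (x, x') \<in> S \<longrightarrow> cinner x (snd p) = cinner (J x) (C (fst p))}"
    by (intro closed_Collect_all closed_Collect_imp closed_Collect_eq open_Collect_const
        continuous_intros bounded_linear.continuous_on[OF bounded_linear_C])
  have 1: "cinner (J x) (C g) = 0" if "(x, x') \<in> S" for x x'
    using subsetD[OF closure_minimal[OF N_sub N_closed] assms] that by auto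
  have "J ` Domain S \<subseteq> {h. cinner h (C g) = 0}" using 1 by auto
  moreover have "closed {h. cinner h (C g) = 0}"
    by (intro closed_Collect_eq continuous_intros)
  moreover have "g \<in> \<DD>" using assms by (rule closure_N_D)
  ultimately have "cinner g (C g) = 0" using closure_minimal by blast
  then have "cinner (C g) g = 0" using cinner_commute[of "C g" g] by simp
  then show ?thesis using Re_cinner_C[of g] by simp
qed

lemma closure_N_single: "(g, x) \<in> closure N \<Longrightarrow> (h, x) \<in> closure N \<Longrightarrow> g = h"
  using N_closable[of "g - h"] complex_vector.subspace_diff[OF csubspace_closure[OF csubspace_N], of "(g, x)" "(h, x)"]
  by simp

text \<open>Convergence with respect to the form amounts to lifting u to a sequence of pairs in N
  that converges in both entries. The closure of the form can thus be read off the closure of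
  N.\<close>

lemma form_conv_inverse_form:
  "form_conv inverse_form u \<phi> \<longleftrightarrow>
    (\<exists>g j. (\<forall>n. (j n, u n) \<in> N) \<and> j \<longlonglongrightarrow> g \<and> u \<longlonglongrightarrow> \<phi>)" (is "?l \<longleftrightarrow> ?r")
proof
  assume ?l
  then have u: "\<And>n. u n \<in> Range S" "u \<longlonglongrightarrow> \<phi>"
    "\<And>e. e > 0 \<Longrightarrow> \<exists>N. \<forall>m\<ge>N. \<forall>n\<ge>N. cmod (fval inverse_form (u n - u m) (u n - u m)) < e"
    by (auto simp: form_conv_def form_of_rel_def)
  have "\<forall>n. \<exists>x. (x, u n) \<in> S" using u(1) by auto
  then obtain x where x: "\<And>n. (x n, u n) \<in> S" by metis
  have diff: "(x n - x m, u n - u m) \<in> S" "J (x n - x m) = J (x n) - J (x m)" for n m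
    using S_diff[OF x x] J_diff[of "x n" "x m"] x by auto
  have "Cauchy (\<lambda>n. J (x n))"
    unfolding Cauchy_iff_C using u(3) by (simp add: cmod_fval_inverse_form[OF diff(1)] diff(2))
  then obtain g where "(\<lambda>n. J (x n)) \<longlonglongrightarrow> g" using Cauchy_convergent convergent_def by blast
  moreover have "(J (x n), u n) \<in> N" for n using x by (force simp: N_def)
  ultimately show ?r using u(2) by (intro exI[of _ g] exI[of _ "\<lambda>n. J (x n)"]) auto
next
  assume ?r
  then obtain g j where j: "\<And>n. (j n, u n) \<in> N" "j \<longlonglongrightarrow> g" "u \<longlonglongrightarrow> \<phi>" by blast
  have "\<forall>n. \<exists>x. (x, u n) \<in> S \<and> j n = J x" using j(1) N_iff by blast
  then obtain x where x: "\<And>n. (x n, u n) \<in> S" "\<And>n. j n = J (x n)" by metis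
  have diff: "(x n - x m, u n - u m) \<in> S" "J (x n - x m) = j n - j m" for n m
    using S_diff[OF x(1) x(1)] J_diff[of "x n" "x m"] x by auto
  have "\<forall>e>0. \<exists>N. \<forall>m\<ge>N. \<forall>n\<ge>N. cmod (fval inverse_form (u n - u m) (u n - u m)) < e"
    using LIMSEQ_imp_Cauchy[OF j(2)]
    by (simp add: Cauchy_iff_C cmod_fval_inverse_form[OF diff(1)] diff(2))
  moreover have "u n \<in> Range S" for n using x(1) by blast
  ultimately show ?l using j(3) by (auto simp: form_conv_def form_of_rel_def)
qed

lemma fdom_closure_inverse_form: "fdom (form_closure inverse_form) = Range (closure N)"
proof -
  have "(\<exists>u. form_conv inverse_form u \<phi>) \<longleftrightarrow> \<phi> \<in> Range (closure N)" for \<phi>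
  proof
    assume "\<exists>u. form_conv inverse_form u \<phi>"
    then obtain u g j where j: "\<And>n. (j n, u n) \<in> N" "j \<longlonglongrightarrow> g" "u \<longlonglongrightarrow> \<phi>"
      unfolding form_conv_inverse_form by blast
    then have "(g, \<phi>) \<in> closure N"
      unfolding closure_sequential by (intro exI[of _ "\<lambda>n. (j n, u n)"]) (auto intro: tendsto_Pair)
    then show "\<phi> \<in> Range (closure N)" by blast
  next
    assume "\<phi> \<in> Range (closure N)"
    then obtain g where "(g, \<phi>) \<in> closure N" by blast
    then obtain v where v: "\<And>n. v n \<in> N" "v \<longlonglongrightarrow> (g, \<phi>)"
      unfolding closure_sequential by blast
    then have "form_conv inverse_form (\<lambda>n. snd (v n)) \<phi>"
      unfolding form_conv_inverse_form
      using tendsto_fst[OF v(2)] tendsto_snd[OF v(2)]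
      by (intro exI[of _ g] exI[of _ "\<lambda>n. fst (v n)"]) auto
    then show "\<exists>u. form_conv inverse_form u \<phi>" by blast
  qed
  then show ?thesis by (auto simp: form_closure_def)
qed

lemma fval_closure_inverse_form:
  assumes "(g, \<phi>) \<in> closure N" "(h, \<psi>) \<in> closure N"
  shows "fval (form_closure inverse_form) \<phi> \<psi> = cinner g (C h)"
proof -
  have lim: "(\<lambda>n. fval inverse_form (u n) (v n)) \<longlonglongrightarrow> cinner g (C h)"
    if u: "form_conv inverse_form u \<phi>" and v: "form_conv inverse_form v \<psi>" for u v
  proof -
    obtain g' j where j: "\<And>n. (j n, u n) \<in> N" "j \<longlonglongrightarrow> g'" "u \<longlonglongrightarrow> \<phi>"
      using u unfolding form_conv_inverse_form by blast
    obtain h' i where i: "\<And>n. (i n, v n) \<in> N" "i \<longlonglongrightarrow> h'" "v \<longlonglongrightarrow> \<psi>"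
      using v unfolding form_conv_inverse_form by blast
    have "(g', \<phi>) \<in> closure N"
      unfolding closure_sequential using j by (intro exI[of _ "\<lambda>n. (j n, u n)"]) (auto intro: tendsto_Pair)
    then have g': "g' = g" using assms(1) closure_N_single by blast
    have "(h', \<psi>) \<in> closure N"
      unfolding closure_sequential using i by (intro exI[of _ "\<lambda>n. (i n, v n)"]) (auto intro: tendsto_Pair)
    then have h': "h' = h" using assms(2) closure_N_single by blast
    have "fval inverse_form (u n) (v n) = cinner (j n) (C (i n))" for n
      using j(1)[of n] i(1)[of n] fval_inverse_form by (auto simp: N_def)
    moreover have "(\<lambda>n. cinner (j n) (C (i n))) \<longlonglongrightarrow> cinner g (C h)"
      using j(2) i(2) unfolding g' h' by (intro tendsto_intros)
    ultimately show ?thesis by simp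
  qed
  have "\<phi> \<in> fdom (form_closure inverse_form)" "\<psi> \<in> fdom (form_closure inverse_form)"
    using assms by (auto simp: fdom_closure_inverse_form)
  then obtain u v where uv: "form_conv inverse_form u \<phi>" "form_conv inverse_form v \<psi>"
    by (auto simp: form_closure_def)
  have "(THE c. \<forall>u v. form_conv inverse_form u \<phi> \<and> form_conv inverse_form v \<psi> \<longrightarrow>
      (\<lambda>n. fval inverse_form (u n) (v n)) \<longlonglongrightarrow> c) = cinner g (C h)"
    using lim uv LIMSEQ_unique by (intro the_equality) blast+
  then show ?thesis by (simp add: form_closure_def)
qed

section \<open>The Krein extension and its closed form\<close>

text \<open>By continuity the equation in \<open>rel_of_form\<close> need only be tested on N, where
  it reads (\<omega>, x') = (g, C J x), the defining equation of K^*.\<close>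

lemma krein_ext_iff:
  "(\<omega>, \<phi>) \<in> krein_ext S \<longleftrightarrow> (\<exists>g. (g, \<phi>) \<in> closure N \<and> (\<omega>, g) \<in> adjoint_rel K)"
proof -
  have "(\<forall>\<psi>\<in>Range (closure N). fval (form_closure inverse_form) \<phi> \<psi> = cinner \<omega> \<psi>) \<longleftrightarrow> (\<omega>, g) \<in> adjoint_rel K"
    if g: "(g, \<phi>) \<in> closure N" for g
  proof
    assume *: "\<forall>\<psi>\<in>Range (closure N). fval (form_closure inverse_form) \<phi> \<psi> = cinner \<omega> \<psi>"
    have "cinner \<omega> x' = cinner g (C (J x))" if "(x, x') \<in> S" for x x'
    proof -
      have "(J x, x') \<in> closure N" using that closure_subset[of N] by (force simp: N_def)
      then show ?thesis using * fval_closure_inverse_form[OF g] by force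
    qed
    then show "(\<omega>, g) \<in> adjoint_rel K" by (simp add: adjoint_K_iff)
  next
    assume "(\<omega>, g) \<in> adjoint_rel K"
    then have "N \<subseteq> {p. cinner \<omega> (snd p) = cinner g (C (fst p))}"
      by (auto simp: adjoint_K_iff N_def)
    then have "closure N \<subseteq> {p. cinner \<omega> (snd p) = cinner g (C (fst p))}"
      by (rule closure_minimal)
        (intro closed_Collect_eq continuous_intros bounded_linear.continuous_on[OF bounded_linear_C])
    then show "\<forall>\<psi>\<in>Range (closure N). fval (form_closure inverse_form) \<phi> \<psi> = cinner \<omega> \<psi>"
      using fval_closure_inverse_form[OF g] by fastforce
  qed
  then show ?thesis
    unfolding krein_ext_def friedrichs_ext_def rel_of_form_def fdom_closure_inverse_form by blast
qed

text \<open>The right-hand side says that {C g, \<phi>} is in the adjoint of \<open>TK\<close>.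
  Conversely to the plain limit argument, this is upgraded to {C g, \<phi>} \<in> K^** = closure of
  K, and C is then cancelled in the approximating sequence.\<close>

lemma closure_N_iff:
  assumes "g \<in> \<DD>"
  shows "(g, \<phi>) \<in> closure N \<longleftrightarrow> (\<forall>\<psi> p. (\<psi>, p) \<in> TK \<longrightarrow> cinner (C g) p = cinner \<phi> \<psi>)"
proof
  assume g: "(g, \<phi>) \<in> closure N"
  show "\<forall>\<psi> p. (\<psi>, p) \<in> TK \<longrightarrow> cinner (C g) p = cinner \<phi> \<psi>"
  proof (intro allI impI)
    fix \<psi> p assume p: "(\<psi>, p) \<in> TK"
    have "cinner (C (J x)) p = cinner x' \<psi>" if "(x, x') \<in> S" for x x'
    proof -
      have "cinner \<psi> x' = cinner p (C (J x))" using p that by (auto simp: TK_iff adjoint_K_iff)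
      then show ?thesis using cinner_commute by metis
    qed
    then have "N \<subseteq> {q. cinner (C (fst q)) p = cinner (snd q) \<psi>}"
      by (auto simp: N_def)
    then have "closure N \<subseteq> {q. cinner (C (fst q)) p = cinner (snd q) \<psi>}"
      by (rule closure_minimal)
        (intro closed_Collect_eq continuous_intros bounded_linear.continuous_on[OF bounded_linear_C])
    then show "cinner (C g) p = cinner \<phi> \<psi>" using g by auto
  qed
next
  assume *: "\<forall>\<psi> p. (\<psi>, p) \<in> TK \<longrightarrow> cinner (C g) p = cinner \<phi> \<psi>"
  have "cinner (C g) q = cinner \<phi> \<psi>" if q: "(\<psi>, q) \<in> adjoint_rel K" for \<psi> q
  proof -
    \<comment> \<open>The vectors C J x and C g lie in \<DD> by \<open>C_D\<close>, so replacing q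
      by its projection p alters neither membership in K^* nor the pairing with C g.\<close>
    obtain p where p: "p \<in> \<DD>" "q - p \<in> ortho_compl \<DD>"
      using ortho_projection_exists[OF csubspace_D closed_closure] by blast
    have "cinner (q - p) (C (J x)) = 0" if "(x, x') \<in> S" for x x'
      using p(2) C_D[of "J x"] that closure_subset[of "J ` Domain S"] by (auto simp: ortho_compl_def)
    then have "(\<psi>, p) \<in> adjoint_rel K"
      using q by (auto simp: adjoint_K_iff cinner_diff_left)
    then have "cinner (C g) p = cinner \<phi> \<psi>" using * p(1) by (auto simp: TK_iff)
    moreover have "cinner (q - p) (C g) = 0"
      using p(2) C_D[OF assms] by (auto simp: ortho_compl_def)
    then have "cinner (C g) (q - p) = 0" using cinner_commute[of "C g" "q - p"] by simp
    ultimately show ?thesis by (simp add: cinner_diff_right)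
  qed
  then have "(C g, \<phi>) \<in> adjoint_rel (adjoint_rel K)" by (simp add: adjoint_rel_iff[of "C g"])
  then have "(C g, \<phi>) \<in> closure K" by (simp add: adjoint_rel_adjoint_rel csubspace_K)
  then obtain v where v: "\<And>n. v n \<in> K" "v \<longlonglongrightarrow> (C g, \<phi>)"
    unfolding closure_sequential by blast
  have "\<forall>n. \<exists>j. (j, snd (v n)) \<in> N \<and> fst (v n) = C j"
    using v(1) K_iff_N by (metis prod.collapse)
  then obtain j where j: "\<And>n. (j n, snd (v n)) \<in> N" "\<And>n. fst (v n) = C (j n)" by metis
  have "(\<lambda>n. C (j n)) \<longlonglongrightarrow> C g" using tendsto_fst[OF v(2)] j(2) by simp
  then have "(\<lambda>n. norm (C (j n) - C g)) \<longlonglongrightarrow> 0"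
    using LIM_zero tendsto_norm_zero by blast
  \<comment> \<open>The lower bound for C recovers j_n \<rightarrow> g from C j_n \<rightarrow> C
    g.\<close>
  moreover have "norm (j n - g) \<le> norm (C (j n) - C g)" for n
    using norm_le_norm_C[of "j n - g"] by (simp add: C_diff)
  ultimately have "(\<lambda>n. j n - g) \<longlonglongrightarrow> 0"
    by (intro Lim_null_comparison[of "\<lambda>n. j n - g" "\<lambda>n. norm (C (j n) - C g)"]) auto
  then have "j \<longlonglongrightarrow> g" using LIM_zero_cancel by blast
  then show "(g, \<phi>) \<in> closure N"
    unfolding closure_sequential using j(1) tendsto_snd[OF v(2)]
    by (intro exI[of _ "\<lambda>n. (j n, snd (v n))"]) (auto intro: tendsto_Pair)
qed

text \<open>The intermediate vector g lies in \<DD> on both sides, by \<open>closure_N_D\<close> and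
  by \<open>TK_iff\<close>, so \<open>closure_N_iff\<close> identifies the two descriptions.\<close>

lemma krein_ext_eq: "krein_ext S = K.H"
proof -
  have "(\<omega>, \<phi>) \<in> krein_ext S \<longleftrightarrow> (\<omega>, \<phi>) \<in> K.H" for \<omega> \<phi>
    unfolding krein_ext_iff K.H_iff using closure_N_iff closure_N_D TK_iff by metis
  then show ?thesis by auto
qed

section \<open>The two implications for a factorized relation\<close>

text \<open>Since \<open>TK\<close> is a closed operator, T^** = closure of T is an operator inside
  it, so its form is closed and restricts the form of S_K. It contains J, and
  \<open>adjoint_K_iff\<close> then yields S \<subseteq> H.\<close>

lemma restriction_extends_S:
  assumes L: "csubspace L" "Domain S \<subseteq> L"
    and T: "T = rel_restrict TK L" and H: "H = adjoint_rel T \<odot> graph_of C \<odot> adjoint_rel (adjoint_rel T)"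
  shows "extremal_maximal_sectorial_ext S H"
proof -
  have cT: "csubspace T" unfolding T by (intro csubspace_rel_restrict K.csubspace_T L)
  have adj: "adjoint_rel (adjoint_rel T) = closure T" by (rule adjoint_rel_adjoint_rel[OF cT])
  have sub: "closure T \<subseteq> TK" by (rule closure_minimal) (auto simp: T rel_restrict_def K.closed_T)
  have sv: "single_valued (closure T)" by (rule single_valued_subset[OF sub K.single_valued_T])
  interpret L: operator_form B "closure T"
    by unfold_locales (simp_all add: csubspace_closure cT sv)
  have H_eq: "H = L.H"
    unfolding H adj L.H_eq_product by (simp add: adjoint_rel_closure)
  have "(x, x') \<in> L.H" if x: "(x, x') \<in> S" for x x'
  proof -
    have "(x, J x) \<in> T" using J_TK[of x] x L(2) by (auto simp: T rel_restrict_def)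
    then have xT: "(x, J x) \<in> closure T" using closure_subset by blast
    have "cinner (C (J x)) p = cinner x' \<psi>" if "(\<psi>, p) \<in> closure T" for \<psi> p
    proof -
      have "cinner \<psi> x' = cinner p (C (J x))"
        using that sub x by (auto simp: TK_iff adjoint_K_iff)
      then show ?thesis using cinner_commute by metis
    qed
    then show ?thesis unfolding L.H_iff using xT by blast
  qed
  then have "S \<subseteq> H" unfolding H_eq by auto
  moreover have "form_restriction L.T_form K.T_form"
    unfolding form_restriction_def
  proof (intro conjI ballI)
    show "fdom L.T_form \<subseteq> fdom K.T_form" using sub by auto
    fix \<phi> \<psi> assume "\<phi> \<in> fdom L.T_form" "\<psi> \<in> fdom L.T_form"
    then obtain g p where "(\<phi>, g) \<in> closure T" "(\<psi>, p) \<in> closure T" by auto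
    moreover then have "(\<phi>, g) \<in> TK" "(\<psi>, p) \<in> TK" using sub by auto
    ultimately show "fval L.T_form \<phi> \<psi> = fval K.T_form \<phi> \<psi>"
      by (simp add: L.fval_T_form K.fval_T_form)
  qed
  ultimately show ?thesis
    unfolding extremal_maximal_sectorial_ext_def krein_ext_eq
    using L.maximal_sectorial_H L.corresponding_T_form K.corresponding_T_form
    unfolding H_eq[symmetric] by (intro conjI exI[of _ L.T_form] exI[of _ K.T_form])
qed

text \<open>L is the domain of the closed form of H. As this form restricts that of
  \<open>TK\<close>, its closedness makes the restriction T of \<open>TK\<close> to L closed, so
  T^** = T and H is the relation of the form of T.\<close>

lemma extremal_imp_restriction:
  assumes "extremal_maximal_sectorial_ext S H"
  shows "\<exists>L T. csubspace L \<and> Domain S \<subseteq> L \<and> L \<subseteq> Domain (adjoint_rel K) \<and>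
    T = rel_restrict TK L \<and> H = adjoint_rel T \<odot> graph_of C \<odot> adjoint_rel (adjoint_rel T)"
proof -
  obtain tH tK where SH: "S \<subseteq> H" and tH: "corresponding_form H tH"
    and tK: "corresponding_form K.H tK" and restr: "form_restriction tH tK"
    using assms unfolding extremal_maximal_sectorial_ext_def krein_ext_eq by blast
  have H: "H = rel_of_form tH" and closed_tH: "closed_form tH" and sq: "sesquilinear_form tH"
    using tH by (auto simp: corresponding_form_def sectorial_form_def)
  \<comment> \<open>All that is known of tK is that its relation is \<open>K.H\<close>; uniqueness
    makes it a restriction of \<open>K.T_form\<close>.\<close>
  have restr': "fdom tH \<subseteq> Domain TK"
    and val: "\<And>\<phi> \<psi>. \<phi> \<in> fdom tH \<Longrightarrow> \<psi> \<in> fdom tH \<Longrightarrow> fval tH \<phi> \<psi> = fval K.T_form \<phi> \<psi>"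
    using restr K.corresponding_form_unique[OF tK] unfolding form_restriction_def K.fdom_T_form by (blast, metis subsetD)
  define L where "L = fdom tH"
  define T where "T = rel_restrict TK L"
  have cL: "csubspace L" unfolding L_def by (rule csubspace_fdom[OF sq])
  have T_iff: "(\<phi>, g) \<in> T \<longleftrightarrow> \<phi> \<in> L \<and> (\<phi>, g) \<in> TK" for \<phi> g
    by (auto simp: T_def rel_restrict_def)
  have dom: "Domain T = L" using restr' by (force simp: T_iff L_def Domain_iff)
  have T_diff: "(x - y, g - h) \<in> TK" if "(x, g) \<in> T" "(y, h) \<in> T" for x y g h
    using that K.T_diff by (auto simp: T_iff)
  have cT: "csubspace T" unfolding T_def by (intro csubspace_rel_restrict K.csubspace_T cL)
  have "closed T"
    unfolding closed_sequential_limits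
  proof (intro allI impI, elim conjE)
    fix v l assume v: "\<forall>n. v n \<in> T" "v \<longlonglongrightarrow> l"
    define u where "u = (\<lambda>n. fst (v n))"
    define h where "h = (\<lambda>n. snd (v n))"
    have u: "(u n, h n) \<in> T" for n using v(1) by (simp add: u_def h_def)
    have uL: "u n \<in> L" for n using u by (simp add: T_iff)
    have lim: "u \<longlonglongrightarrow> fst l" "h \<longlonglongrightarrow> snd l"
      unfolding u_def h_def by (intro tendsto_fst v tendsto_snd v)+
    have "form_conv tH u (fst l)"
      unfolding form_conv_def
    proof (intro conjI allI impI lim)
      show "u n \<in> fdom tH" for n using uL by (simp add: L_def)
      fix e :: real assume e: "e > 0"
      have "fval tH (u j - u i) (u j - u i) = cinner (C (h j - h i)) (h j - h i)" for i j
      proof -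
        have "u j - u i \<in> fdom tH"
          using complex_vector.subspace_diff[OF cL uL uL] by (simp add: L_def)
        then show ?thesis
          using val K.fval_T_form[OF T_diff[OF u u] T_diff[OF u u]] by metis
      qed
      then show "\<exists>N. \<forall>i\<ge>N. \<forall>j\<ge>N. cmod (fval tH (u j - u i) (u j - u i)) < e"
        using LIMSEQ_imp_Cauchy[OF lim(2)] e by (simp add: Cauchy_iff_C)
    qed
    then have "fst l \<in> L" using closed_tH by (auto simp: closed_form_def L_def)
    moreover have "v n \<in> TK" for n
      using v(1)[rule_format, of n] by (cases "v n") (auto simp: T_iff)
    then have "l \<in> TK"
      using closed_sequentially[OF K.closed_T, of v l] v(2) by blast
    ultimately show "l \<in> T" by (cases l) (simp add: T_iff)
  qed
  interpret L: operator_form B T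
  proof unfold_locales
    show "csubspace T" "closed T" by fact+
    show "single_valued T"
      by (rule single_valued_subset[OF _ K.single_valued_T]) (auto simp: T_def rel_restrict_def)
  qed
  have "fval tH \<phi> \<psi> = fval L.T_form \<phi> \<psi>" if "\<phi> \<in> L" "\<psi> \<in> L" for \<phi> \<psi>
  proof -
    obtain g p where gp: "(\<phi>, g) \<in> T" "(\<psi>, p) \<in> T" using dom \<open>\<phi> \<in> L\<close> \<open>\<psi> \<in> L\<close> by blast
    then have "(\<phi>, g) \<in> TK" "(\<psi>, p) \<in> TK" by (auto simp: T_iff)
    then show ?thesis
      using val[of \<phi> \<psi>] that gp by (simp add: K.fval_T_form L.fval_T_form L_def)
  qed
  then have "H = L.H" unfolding H rel_of_form_def by (auto simp: dom simp flip: L_def)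
  also have "\<dots> = adjoint_rel T \<odot> graph_of C \<odot> adjoint_rel (adjoint_rel T)"
    unfolding L.H_eq_product using adjoint_rel_adjoint_rel[OF cT] L.closed_T by simp
  finally have "H = adjoint_rel T \<odot> graph_of C \<odot> adjoint_rel (adjoint_rel T)" .
  moreover have "Domain S \<subseteq> L"
    using SH by (auto simp: H L_def rel_of_form_def)
  moreover have "L \<subseteq> Domain (adjoint_rel K)"
    using subsetD[OF restr'] by (fastforce simp: L_def TK_iff)
  ultimately show ?thesis using cL T_def by blast
qed

end


section \<open>Pairs of maximal sectorial relations\<close>

lemma bounded_selfadjoint_imp_symmetric:
  assumes "bounded_selfadjoint B"
  shows "bounded_symmetric B"
proof (rule bounded_symmetric.intro)
  show "bounded_linear B" using assms by (simp add: bounded_selfadjoint_def)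
  fix x y
  have "(x, B x) \<in> adjoint_rel (graph_of B)"
    using assms by (simp add: bounded_selfadjoint_def graph_of_def)
  then show "cinner (B x) y = cinner x (B y)"
    by (simp add: adjoint_rel_iff graph_of_def)
qed

lemma bounded_symmetric_map_prod:
  fixes B1 :: "'a::complex_hilbert \<Rightarrow> 'a" and B2 :: "'b::complex_hilbert \<Rightarrow> 'b"
  assumes "bounded_symmetric B1" "bounded_symmetric B2"
  shows "bounded_symmetric (map_prod B1 B2)"
proof (rule bounded_symmetric.intro)
  interpret B1: bounded_symmetric B1 by fact
  interpret B2: bounded_symmetric B2 by fact
  have eq: "map_prod B1 B2 = (\<lambda>p. (B1 (fst p), B2 (snd p)))" by (auto simp: fun_eq_iff)
  show "bounded_linear (map_prod B1 B2)"
    unfolding eq by (intro bounded_linear_Pair bounded_linear_compose[OF B1.bounded bounded_linear_fst]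
        bounded_linear_compose[OF B2.bounded bounded_linear_snd])
qed (simp add: cinner_prod_def bounded_symmetric.symmetric[OF assms(1)]
    bounded_symmetric.symmetric[OF assms(2)])

lemma one_plus_i_map_prod:
  "one_plus_i (map_prod B1 B2) (x, y) = (one_plus_i B1 x, one_plus_i B2 y)"
  by (simp add: one_plus_i_def scaleC_prod_def)

text \<open>The form vanishes when one argument is 0, so the condition on {0, k} reduces to k being
  orthogonal to the domain.\<close>

lemma rel_mul_form_Re:
  assumes "sesquilinear_form t"
  shows "rel_mul (rel_of_form (form_Re t)) = ortho_compl (fdom t)"
proof -
  have 0: "0 \<in> fdom t" using assms csubspace_fdom complex_vector.subspace_0 by blast
  have "fval t 0 x = 0" "fval t x 0 = 0" if "x \<in> fdom t" for x
    using sesquilinear_formD(3,4)[OF assms 0 that 0, of 0] sesquilinear_formD(4)[OF assms that 0 0, of 0]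
    by auto
  then show ?thesis
    using 0 by (auto simp: rel_mul_def rel_of_form_def form_Re_def ortho_compl_def)
qed

text \<open>Adding this identity for both relations of the pair gives (f', h) = (C J f, J h) on
  their sum.\<close>

lemma half_power_data_fval:
  assumes "corresponding_form H t" "half_power_data t A R B"
    and "(f, f') \<in> H" "(f, g) \<in> R" "(h, k) \<in> R"
  shows "cinner f' h = cinner (one_plus_i B g) k"
proof -
  have "h \<in> fdom t" "fval t f h = cinner (one_plus_i B g) k"
    using assms(2,4,5) by (auto simp: half_power_data_def)
  then show ?thesis using assms(1,3) by (auto simp: corresponding_form_def rel_of_form_def)
qed

lemma half_power_data_single_valued: "half_power_data t A R B \<Longrightarrow> single_valued R"
  and half_power_data_csubspace: "half_power_data t A R B \<Longrightarrow> csubspace R"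
  by (auto simp: half_power_data_def nonneg_sqrt_in_def nonneg_selfadjoint_operator_in_def
      linear_relation_def)

lemma half_power_data_Domain: "corresponding_form H t \<Longrightarrow> half_power_data t A R B \<Longrightarrow> Domain H \<subseteq> Domain R"
  by (auto simp: half_power_data_def corresponding_form_def rel_of_form_def)

text \<open>The factorization H = A^{1/2} (I + iB) A^{1/2}. The part of f' in mul A is split off;
  the rest and C g are both orthogonal to mul A, where R is its own adjoint, so the adjoint relation
  given by the form is a relation in R.\<close>

lemma half_power_data_product:
  assumes H: "corresponding_form H t" and R: "half_power_data t A R B"
  shows "(f, f') \<in> H \<longleftrightarrow> (\<exists>g. (f, g) \<in> R \<and> (one_plus_i B g, f') \<in> add_mul R (rel_mul A))"
proof
  let ?N = "rel_mul A"
  let ?M = "ortho_compl ?N"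
  have sq: "sesquilinear_form t" and H_eq: "H = rel_of_form t"
    using H by (auto simp: corresponding_form_def sectorial_form_def)
  have A: "A = rel_of_form (form_Re t)" and dom: "fdom t = Domain R"
    and B0: "\<And>x y. x \<in> rel_ker A \<Longrightarrow> y \<in> ?N \<Longrightarrow> B (x + y) = 0"
    and R_sub: "R \<subseteq> ?M \<times> ?M" and R_adj: "adjoint_rel R \<inter> ?M \<times> ?M = R"
    and val: "\<And>h h' k k'. (h, h') \<in> R \<Longrightarrow> (k, k') \<in> R \<Longrightarrow> fval t h k = cinner (one_plus_i B h') k'"
    and B_sa: "bounded_selfadjoint B"
    using R by (auto simp: half_power_data_def nonneg_sqrt_in_def nonneg_selfadjoint_operator_in_def)
  interpret bounded_symmetric B by (rule bounded_selfadjoint_imp_symmetric[OF B_sa])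
  have N: "?N = ortho_compl (Domain R)" using rel_mul_form_Re[OF sq] A dom by simp
  {
    assume f: "(f, f') \<in> H"
    then obtain g where g: "(f, g) \<in> R" using H_eq dom by (auto simp: rel_of_form_def)
    obtain m where m: "m \<in> ?N" "f' - m \<in> ?M"
      using ortho_projection_exists[of ?N f'] N csubspace_ortho_compl closed_ortho_compl by metis
    have mD: "cinner m h = 0" if "(h, k) \<in> R" for h k
      using m(1) that unfolding N by (auto simp: ortho_compl_def)
    have adj: "(C g, f' - m) \<in> adjoint_rel R"
      unfolding adjoint_rel_iff
      using half_power_data_fval[OF H R f g] mD by (simp add: cinner_diff_left)
    have "0 \<in> rel_ker A"
      using N csubspace_ortho_compl[of "Domain R"] complex_vector.subspace_0
      by (auto simp: rel_ker_def rel_mul_def)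
    then have "B n = 0" if "n \<in> ?N" for n using B0[of 0 n] that by simp
    \<comment> \<open>B is symmetric and vanishes on mul A, so (B g, n) = (g, B n) = 0 for n in mul
      A.\<close>
    then have "B g \<in> ?M" using symmetric by (auto simp: ortho_compl_def)
    moreover have "g \<in> ?M" using g R_sub by auto
    ultimately have "C g \<in> ?M"
      unfolding one_plus_i_def
      by (intro complex_vector.subspace_add complex_vector.subspace_scale csubspace_ortho_compl)
    then have "(C g, f' - m) \<in> R" using adj m(2) R_adj by blast
    then have "(C g, f') \<in> add_mul R ?N" using m(1) by (force simp: add_mul_def)
    then show "\<exists>g. (f, g) \<in> R \<and> (C g, f') \<in> add_mul R ?N" using g by blast
  }
  assume "\<exists>g. (f, g) \<in> R \<and> (C g, f') \<in> add_mul R ?N"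
  then obtain g h m where g: "(f, g) \<in> R" "(C g, h) \<in> R" "m \<in> ?N" "f' = h + m"
    by (auto simp: add_mul_def)
  have "fval t f \<psi> = cinner f' \<psi>" if \<psi>: "\<psi> \<in> fdom t" for \<psi>
  proof -
    obtain p where p: "(\<psi>, p) \<in> R" using \<psi> dom by auto
    have "(C g, h) \<in> adjoint_rel R" using g(2) R_adj by blast
    then have "cinner (C g) p = cinner h \<psi>" using p by (simp add: adjoint_rel_iff)
    moreover have "cinner m \<psi> = 0" using g(3) p unfolding N by (auto simp: ortho_compl_def)
    ultimately show ?thesis using val[OF g(1) p] g(4) by (simp add: cinner_add_left)
  qed
  then show "(f, f') \<in> H" using g(1) dom H_eq by (auto simp: rel_of_form_def)
qed

theorem proposition3p4:
  fixes H1 H2 A1 A2 R1 R2 Q1 Q2 Ht :: "('a::complex_hilbert \<times> 'a) set"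
    and t1 t2 :: "'a form"
    and B1 B2 :: "'a \<Rightarrow> 'a"
    and K :: "(('a \<times> 'a) \<times> 'a) set"
  assumes "maximal_sectorial H1" and "maximal_sectorial H2"
    and "corresponding_form H1 t1" and "corresponding_form H2 t2"
    and "half_power_data t1 A1 R1 B1" and "half_power_data t2 A2 R2 B2"
    and "Q1 = add_mul R1 (rel_mul A1)" and "Q2 = add_mul R2 (rel_mul A2)"
    and "K = rel_K R1 R2 B1 B2 Q1 Q2"
    and "closure (space_E0 (Domain H1 \<inter> Domain H2) R1 R2) =
         closure (space_D0 (Domain H1 \<inter> Domain H2) R1 R2 B1 B2)"
    and "linear_relation Ht"
  shows "extremal_maximal_sectorial_ext (H1 \<boxplus> H2) Ht \<longleftrightarrow>
    (\<exists>L T. csubspace L \<and> Domain (H1 \<boxplus> H2) \<subseteq> L \<and> L \<subseteq> Domain (adjoint_rel K) \<and>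
      T = rel_restrict (operator_part (adjoint_rel K)) L \<and>
      Ht = adjoint_rel T \<odot> graph_of (one_plus_i (map_prod B1 B2)) \<odot> adjoint_rel (adjoint_rel T))"
proof -
  note t1 = assms(3) and t2 = assms(4) and R1 = assms(5) and R2 = assms(6)
  define S where "S = H1 \<boxplus> H2"
  define D where "D = Domain H1 \<inter> Domain H2"
  \<comment> \<open>Both descriptions denote the operator values on D; elsewhere J may be arbitrary,
    as it is evaluated only on D.\<close>
  define J where "J f = (THE g. (f, g) \<in> R1, THE g. (f, g) \<in> R2)" for f
  let ?C = "one_plus_i (map_prod B1 B2)"
  have S_iff: "(f, f') \<in> S \<longleftrightarrow> (\<exists>f1 f2. (f, f1) \<in> H1 \<and> (f, f2) \<in> H2 \<and> f' = f1 + f2)" for f f'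
    by (auto simp: S_def rel_sum_def)
  have dom_S: "Domain S = D" by (simp add: D_def set_eq_iff Domain_iff S_iff) blast
  have J_eq: "J f = (g1, g2)" if "(f, g1) \<in> R1" "(f, g2) \<in> R2" for f g1 g2
    using that single_valuedD[OF half_power_data_single_valued[OF R1]]
      single_valuedD[OF half_power_data_single_valued[OF R2]]
    by (auto simp: J_def intro!: the_equality)
  have D: "\<exists>g1 g2. (f, g1) \<in> R1 \<and> (f, g2) \<in> R2" if "f \<in> D" for f
    using that half_power_data_Domain[OF t1 R1] half_power_data_Domain[OF t2 R2] by (auto simp: D_def)
  have E0: "space_E0 D R1 R2 = J ` D"
    using D J_eq by (force simp: space_E0_def image_iff)
  have D0: "space_D0 D R1 R2 B1 B2 = ?C ` J ` D"
  proof -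
    have "space_D0 D R1 R2 B1 B2 = ?C ` space_E0 D R1 R2"
      by (force simp: space_D0_def space_E0_def image_iff one_plus_i_map_prod)
    then show ?thesis by (simp add: E0)
  qed
  have sub: "csubspace H1" "csubspace H2" "csubspace R1" "csubspace R2"
    using assms(1,2) half_power_data_csubspace[OF R1] half_power_data_csubspace[OF R2]
    by (auto simp: maximal_sectorial_def sectorial_def linear_relation_def)
  interpret F: factorized_relation "map_prod B1 B2" S J
  proof (intro factorized_relation.intro factorized_relation_axioms.intro)
    show "bounded_symmetric (map_prod B1 B2)"
      using R1 R2 by (intro bounded_symmetric_map_prod bounded_selfadjoint_imp_symmetric)
        (simp_all add: half_power_data_def)
    have "(f + g, f1 + f2 + (g1 + g2)) \<in> S"
      if "(f, f1) \<in> H1" "(f, f2) \<in> H2" "(g, g1) \<in> H1" "(g, g2) \<in> H2" for f g f1 f2 g1 g2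
      unfolding S_iff
      by (rule exI[of _ "f1 + g1"], rule exI[of _ "f2 + g2"])
        (use that sub in \<open>auto simp: csubspace_rel_iff\<close>)
    moreover have "(a *\<^sub>C f, a *\<^sub>C (f1 + f2)) \<in> S" if "(f, f1) \<in> H1" "(f, f2) \<in> H2" for a f f1 f2
      unfolding S_iff
      by (rule exI[of _ "a *\<^sub>C f1"], rule exI[of _ "a *\<^sub>C f2"])
        (use that sub in \<open>auto simp: csubspace_rel_iff scaleC_add_right\<close>)
    moreover have "(0, 0) \<in> S"
      unfolding S_iff by (rule exI[of _ 0], rule exI[of _ 0]) (use sub in \<open>auto simp: csubspace_rel_iff\<close>)
    ultimately show "csubspace S"
      unfolding csubspace_rel_iff S_iff by blast
  next
    fix x y assume "x \<in> Domain S" "y \<in> Domain S"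
    then obtain x1 x2 y1 y2 where *: "(x, x1) \<in> R1" "(x, x2) \<in> R2" "(y, y1) \<in> R1" "(y, y2) \<in> R2"
      using D[of x] D[of y] unfolding dom_S by auto
    then have "(x + y, x1 + y1) \<in> R1" "(x + y, x2 + y2) \<in> R2"
      using sub by (auto simp: csubspace_rel_iff)
    then show "J (x + y) = J x + J y" using * J_eq by simp
  next
    fix x a assume "x \<in> Domain S"
    then obtain x1 x2 where *: "(x, x1) \<in> R1" "(x, x2) \<in> R2"
      using D unfolding dom_S by blast
    then have "(a *\<^sub>C x, a *\<^sub>C x1) \<in> R1" "(a *\<^sub>C x, a *\<^sub>C x2) \<in> R2"
      using sub by (auto simp: csubspace_rel_iff)
    then show "J (a *\<^sub>C x) = a *\<^sub>C J x" using * J_eq by (simp add: scaleC_prod_def)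
  next
    fix x x' y assume x: "(x, x') \<in> S" and y: "y \<in> Domain S"
    obtain f1 f2 where f: "(x, f1) \<in> H1" "(x, f2) \<in> H2" "x' = f1 + f2" using x S_iff by blast
    obtain x1 x2 where xx: "(x, x1) \<in> R1" "(x, x2) \<in> R2" using x D dom_S by blast
    obtain y1 y2 where yy: "(y, y1) \<in> R1" "(y, y2) \<in> R2" using y D dom_S by blast
    show "cinner x' y = cinner (?C (J x)) (J y)"
      using half_power_data_fval[OF t1 R1 f(1) xx(1) yy(1)] half_power_data_fval[OF t2 R2 f(2) xx(2) yy(2)]
      by (simp add: J_eq[OF xx] J_eq[OF yy] one_plus_i_map_prod cinner_prod_def f(3) cinner_add_left)
  next
    show "closure (J ` Domain S) = closure (?C ` J ` Domain S)"
      using assms(10) by (simp only: dom_S D_def[symmetric] E0 D0)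
  qed
  \<comment> \<open>The definition of K does not mention H_1 and H_2: by the factorization, {C_j
    g_j, f_j'} \<in> A_j^{1/2} with g_j the value of the operator part at f means {f, f_j'} \<in>
    H_j. Hence K consists of the pairs {C J f, f'} with {f, f'} \<in> S.\<close>
  have "F.K = K"
  proof -
    have "(p, f') \<in> F.K \<longleftrightarrow> (p, f') \<in> K" for p f'
    proof -
      have "(p, f') \<in> F.K \<longleftrightarrow> (\<exists>f. (f, f') \<in> S \<and> p = ?C (J f))"
        by (force simp: F.K_def)
      also have "\<dots> \<longleftrightarrow> (\<exists>f g1 g2. (f, f') \<in> S \<and> (f, g1) \<in> R1 \<and> (f, g2) \<in> R2 \<and>
          p = (one_plus_i B1 g1, one_plus_i B2 g2))"
      proof (intro iffI; elim exE conjE)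
        fix f assume f: "(f, f') \<in> S" "p = ?C (J f)"
        then obtain g1 g2 where "(f, g1) \<in> R1" "(f, g2) \<in> R2" using D dom_S by blast
        then show "\<exists>f g1 g2. (f, f') \<in> S \<and> (f, g1) \<in> R1 \<and> (f, g2) \<in> R2 \<and>
            p = (one_plus_i B1 g1, one_plus_i B2 g2)"
          using f by (intro exI[of _ f] exI[of _ g1] exI[of _ g2]) (simp add: J_eq one_plus_i_map_prod)
      next
        fix f g1 g2
        assume "(f, f') \<in> S" "(f, g1) \<in> R1" "(f, g2) \<in> R2" "p = (one_plus_i B1 g1, one_plus_i B2 g2)"
        then show "\<exists>f. (f, f') \<in> S \<and> p = ?C (J f)"
          by (intro exI[of _ f]) (simp add: J_eq one_plus_i_map_prod)
      qed
      also have "\<dots> \<longleftrightarrow> (\<exists>f g1 g2 f1 f2. (f, f1) \<in> H1 \<and> (f, f2) \<in> H2 \<and> f' = f1 + f2 \<and>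
          (f, g1) \<in> R1 \<and> (f, g2) \<in> R2 \<and> p = (one_plus_i B1 g1, one_plus_i B2 g2))"
        unfolding S_iff by blast
      also have "\<dots> \<longleftrightarrow> (\<exists>f g1 g2 f1 f2. (one_plus_i B1 g1, f1) \<in> Q1 \<and> (one_plus_i B2 g2, f2) \<in> Q2 \<and>
          f' = f1 + f2 \<and> (f, g1) \<in> R1 \<and> (f, g2) \<in> R2 \<and> p = (one_plus_i B1 g1, one_plus_i B2 g2))"
      proof -
        have "(f, f1) \<in> H1 \<longleftrightarrow> (one_plus_i B1 g1, f1) \<in> Q1" if "(f, g1) \<in> R1" for f f1 g1
          unfolding half_power_data_product[OF t1 R1] assms(7)
          using that single_valuedD[OF half_power_data_single_valued[OF R1]] by blast
        moreover have "(f, f2) \<in> H2 \<longleftrightarrow> (one_plus_i B2 g2, f2) \<in> Q2" if "(f, g2) \<in> R2" for f f2 g2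
          unfolding half_power_data_product[OF t2 R2] assms(8)
          using that single_valuedD[OF half_power_data_single_valued[OF R2]] by blast
        ultimately show ?thesis by blast
      qed
      also have "\<dots> \<longleftrightarrow> (p, f') \<in> K"
        unfolding assms(9) rel_K_def by blast
      finally show ?thesis .
    qed
    then show ?thesis by auto
  qed
  then show ?thesis
    using F.restriction_extends_S F.extremal_imp_restriction unfolding S_def[symmetric] by blast
qed

end
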